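(* Let $R$ be a commutative unital ring, let $\mathcal{C}^0,\mathcal{C}$ be triangulated subcategories of a triangulated category $\mathcal{D}$, assume that $\mathcal{C}^0$ is $R$-linear, that a weight structure $w^0$ on $\mathcal{C}^0$ is strictly orthogonal to a $t$-structure $t$ on $\mathcal{C}$, and that $\mathcal{A}$ and $\mathcal{A}'$ are weak Serre subcategories of $R\text{-}\mathrm{Mod}$. 1. Then $\mathcal{C}_{\mathcal{A}}$ is triangulated and $t$ restricts to it. The heart $\underline{Ht}_{\mathcal{A}}$ of this restriction $t_{\mathcal{A}}$ consists of those objects $N$ of $\underline{Ht}$ such that the corresponding functor $(\underline{Hw}^0)^{op}\to R\text{-}\mathrm{Mod}$, $M\mapsto\mathcal{D}(M,N)$, takes values in $\mathcal{A}$. 2. $\mathcal{C}_{\mathcal{A}\cap\mathcal{A}'}=\mathcal{C}_{\mathcal{A}}\cap\mathcal{C}_{\mathcal{A}'}$. 3. If $R$ is Noetherian and $\beta$ is an infinite cardinal then the category of $R$-modules with less than $\beta$ generators is a weak Serre subcategory of $R\text{-}\mathrm{Mod}$.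
   Context: Conventions: subcategories are strictly full; $X\perp Y$ means $\mathcal{D}(X,Y)=0$, for classes $D\perp E$ means $X\perp Y$ for all $X\in D$, $Y\in E$; $D^{\perp}=\{Y\in\mathrm{Obj}\,\mathcal{D}:\ X\perp Y\ \forall X\in D\}$. For $M\in\mathrm{Obj}\,\mathcal{C}^0$ and $N\in\mathrm{Obj}\,\mathcal{D}$, the group $\mathcal{D}(M,N)$ is an $R$-module via the action of $R$ on $M$ ($r$ acts by composition with $r\,\mathrm{id}_M$). A weak Serre subcategory of an abelian category is a strictly full subcategory containing the kernels and cokernels of all its morphisms and closed under extensions. For a weak Serre subcategory $\mathcal{A}$ of $R\text{-}\mathrm{Mod}$, $\mathcal{C}_{\mathcal{A}}$ is the full subcategory of $\mathcal{C}$ consisting of those $N$ such that $\mathcal{D}(M,N)\in\mathcal{A}$ for every $M\in\mathrm{Obj}\,\mathcal{C}^0$. A weight structure $w^0=(\mathcal{C}^0_{w^0\le 0},\mathcal{C}^0_{w^0\ge 0})$ on $\mathcal{C}^0$ is a pair of classes of objects closed under retracts such that $\mathcal{C}^0_{w^0\le 0}\subset \mathcal{C}^0_{w^0\le 0}[1]$, $\mathcal{C}^0_{w^0\ge 0}[1]\subset \mathcal{C}^0_{w^0\ge 0}$, $\mathcal{C}^0_{w^0\le 0}\perp \mathcal{C}^0_{w^0\ge 0}[1]$, and every object $M$ of $\mathcal{C}^0$ fits into a distinguished triangle $L\to M\to R'\to L[1]$ in $\mathcal{C}^0$ with $L\in \mathcal{C}^0_{w^0\le 0}$, $R'\in\mathcal{C}^0_{w^0\ge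 0}[1]$. $\underline{Hw}^0$ is the full subcategory with objects $\mathcal{C}^0_{w^0\le 0}\cap \mathcal{C}^0_{w^0\ge 0}$. A $t$-structure $t=(\mathcal{C}_{t\le 0},\mathcal{C}_{t\ge 0})$ on $\mathcal{C}$ (homological convention) is a pair of classes of objects closed under isomorphism such that $\mathcal{C}_{t\le 0}\subset \mathcal{C}_{t\le 0}[1]$, $\mathcal{C}_{t\ge 0}[1]\subset \mathcal{C}_{t\ge 0}$, $\mathcal{C}_{t\ge 0}[1]\perp \mathcal{C}_{t\le 0}$, and every object $M$ fits into a distinguished triangle $L_tM\to M\to R_tM\to L_tM[1]$ with $L_tM\in \mathcal{C}_{t\ge 0}$, $R_tM\in\mathcal{C}_{t\le 0}[-1]$. $\mathcal{C}_{t\le i}=\mathcal{C}_{t\le 0}[i]$, $\mathcal{C}_{t\ge i}=\mathcal{C}_{t\ge 0}[i]$; $\underline{Ht}$ is the full subcategory with objects $\mathcal{C}_{t\le 0}\cap \mathcal{C}_{t\ge 0}$. $t$ restricts to a full triangulated subcategory $\mathcal{C}''$ of $\mathcal{C}$ if $(\mathcal{C}_{t\le 0}\cap\mathrm{Obj}\,\mathcal{C}'',\mathcal{C}_{t\ge 0}\cap\mathrm{Obj}\,\mathcal{C}'')$ is a $t$-structure on $\mathcal{C}''$. $t$ and $w^0$ are strictly orthogonal if $\mathcal{C}_{t\ge 1}=(\mathcal{C}^0_{w^0\le 0})^{\perp}\cap\mathrm{Obj}\,\mathcal{C}$ and $\mathcal{C}_{t\le -1}=(\mathcal{C}^0_{w^0\ge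 0})^{\perp}\cap\mathrm{Obj}\,\mathcal{C}$. *)

theory Defs
  imports "HOL-Algebra.Module" "HOL-Algebra.Ring_Divisibility"
begin

section \<open>Modules\<close>

text \<open>
  The carrier type plays the role of a universe: R-Mod consists of all records \<open>M\<close> of type
  \<open>('r, 'u) module\<close> with \<open>module R M\<close>. The inherited ring fields \<open>mult\<close> and \<open>one\<close> are
  irrelevant; they are ignored by homomorphisms, and classes of modules are required to be closed
  under isomorphism.
\<close>

definition module_hom :: "('r, 'm) ring_scheme \<Rightarrow> ('r, 'u) module \<Rightarrow> ('r, 'v) module \<Rightarrow> ('u \<Rightarrow> 'v) set"
  where "module_hom R M N =
    {f \<in> hom (add_monoid M) (add_monoid N).
       \<forall>r\<in>carrier R. \<forall>x\<in>carrier M. f (r \<odot>\<^bsub>M\<^esub> x) = r \<odot>\<^bsub>N\<^esub> f x}"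

definition module_isomorphic :: "('r, 'm) ring_scheme \<Rightarrow> ('r, 'u) module \<Rightarrow> ('r, 'v) module \<Rightarrow> bool"
  where "module_isomorphic R M N \<longleftrightarrow>
    (\<exists>f\<in>module_hom R M N. bij_betw f (carrier M) (carrier N))"

definition is_module_kernel ::
    "('r, 'm) ring_scheme \<Rightarrow> ('r, 'u) module \<Rightarrow> ('r, 'u) module \<Rightarrow> ('u \<Rightarrow> 'u) \<Rightarrow>
     ('r, 'u) module \<Rightarrow> ('u \<Rightarrow> 'u) \<Rightarrow> bool"
  where "is_module_kernel R M N f K i \<longleftrightarrow>
    module R K \<and> i \<in> module_hom R K M \<and> inj_on i (carrier K) \<and>
    i ` carrier K = a_kernel M N f"

definition is_module_cokernel ::
    "('r, 'm) ring_scheme \<Rightarrow> ('r, 'u) module \<Rightarrow> ('r, 'u) module \<Rightarrow> ('u \<Rightarrow> 'u) \<Rightarrow>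
     ('r, 'u) module \<Rightarrow> ('u \<Rightarrow> 'u) \<Rightarrow> bool"
  where "is_module_cokernel R M N f Q q \<longleftrightarrow>
    module R Q \<and> q \<in> module_hom R N Q \<and> q ` carrier N = carrier Q \<and>
    a_kernel N Q q = f ` carrier M"

definition short_exact ::
    "('r, 'm) ring_scheme \<Rightarrow> ('r, 'u) module \<Rightarrow> ('r, 'u) module \<Rightarrow> ('r, 'u) module \<Rightarrow>
     ('u \<Rightarrow> 'u) \<Rightarrow> ('u \<Rightarrow> 'u) \<Rightarrow> bool"
  where "short_exact R K E Q i q \<longleftrightarrow>
    module R K \<and> module R E \<and> module R Q \<and>
    i \<in> module_hom R K E \<and> q \<in> module_hom R E Q \<and>
    inj_on i (carrier K) \<and> i ` carrier K = a_kernel E Q q \<and> q ` carrier E = carrier Q"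

text \<open>
  A full subcategory is given by its class of objects. Non-emptiness is part of the notion of a
  subcategory of an abelian category here: it amounts to containing the zero modules.
\<close>

definition weak_serre :: "('r, 'm) ring_scheme \<Rightarrow> ('r, 'u) module set \<Rightarrow> bool"
  where "weak_serre R A \<longleftrightarrow>
    A \<noteq> {} \<and> (\<forall>M\<in>A. module R M) \<and>
    (\<forall>M\<in>A. \<forall>N. module R N \<and> module_isomorphic R M N \<longrightarrow> N \<in> A) \<and>
    (\<forall>M\<in>A. \<forall>N\<in>A. \<forall>f\<in>module_hom R M N. \<forall>K i. is_module_kernel R M N f K i \<longrightarrow> K \<in> A) \<and>
    (\<forall>M\<in>A. \<forall>N\<in>A. \<forall>f\<in>module_hom R M N. \<forall>Q q. is_module_cokernel R M N f Q q \<longrightarrow> Q \<in> A) \<and>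
    (\<forall>K\<in>A. \<forall>Q\<in>A. \<forall>E i q. short_exact R K E Q i q \<longrightarrow> E \<in> A)"

definition module_generates :: "('r, 'm) ring_scheme \<Rightarrow> ('r, 'u) module \<Rightarrow> 'u set \<Rightarrow> bool"
  where "module_generates R M S \<longleftrightarrow>
    S \<subseteq> carrier M \<and> (\<forall>H. submodule H R M \<and> S \<subseteq> H \<longrightarrow> H = carrier M)"

definition modules_gen_less :: "('r, 'm) ring_scheme \<Rightarrow> 'b rel \<Rightarrow> ('r, 'u) module set"
  where "modules_gen_less R \<beta> =
    {M. module R M \<and> (\<exists>S. module_generates R M S \<and> (card_of S, \<beta>) \<in> ordLess)}"


section \<open>Triangulated categories\<close>

text \<open>
  \<open>cmp\<close>, \<open>pls\<close> and \<open>shiftA\<close> take no object arguments, since arrows are thought of as knowing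
  their source and target; disjointness of the hom sets is never needed and hence not imposed.
  \<open>(X, Y, Z, f, g, h) \<in> tri\<close> is the triangle with \<open>f : X \<rightarrow> Y\<close>, \<open>g : Y \<rightarrow> Z\<close>, \<open>h : Z \<rightarrow> X[1]\<close>.
\<close>

record ('o, 'u) tricat =
  obj :: "'o set"
  arr :: "'o \<Rightarrow> 'o \<Rightarrow> 'u set"
  ide :: "'o \<Rightarrow> 'u"
  cmp :: "'u \<Rightarrow> 'u \<Rightarrow> 'u" (infixr \<open>\<cdot>\<index>\<close> 70)
  pls :: "'u \<Rightarrow> 'u \<Rightarrow> 'u"
  zer :: "'o \<Rightarrow> 'o \<Rightarrow> 'u"
  shift :: "'o \<Rightarrow> 'o"
  shiftA :: "'u \<Rightarrow> 'u"
  tri :: "('o \<times> 'o \<times> 'o \<times> 'u \<times> 'u \<times> 'u) set"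

definition hom_group :: "('o, 'u, 'z) tricat_scheme \<Rightarrow> 'o \<Rightarrow> 'o \<Rightarrow> 'u ring"
  where "hom_group D X Y =
    \<lparr>carrier = arr D X Y, mult = undefined, one = undefined, zero = zer D X Y, add = pls D\<rparr>"

definition is_iso :: "('o, 'u, 'z) tricat_scheme \<Rightarrow> 'o \<Rightarrow> 'o \<Rightarrow> 'u \<Rightarrow> bool"
  where "is_iso D X Y f \<longleftrightarrow> f \<in> arr D X Y \<and>
    (\<exists>g\<in>arr D Y X. g \<cdot>\<^bsub>D\<^esub> f = ide D X \<and> f \<cdot>\<^bsub>D\<^esub> g = ide D Y)"

definition isomorphic :: "('o, 'u, 'z) tricat_scheme \<Rightarrow> 'o \<Rightarrow> 'o \<Rightarrow> bool"
  where "isomorphic D X Y \<longleftrightarrow> (\<exists>f. is_iso D X Y f)"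

definition is_zero_obj :: "('o, 'u, 'z) tricat_scheme \<Rightarrow> 'o \<Rightarrow> bool"
  where "is_zero_obj D Z \<longleftrightarrow> Z \<in> obj D \<and> ide D Z = zer D Z Z"

locale category =
  fixes D :: "('o, 'u, 'z) tricat_scheme" (structure)
  assumes ide_arr: "X \<in> obj D \<Longrightarrow> ide D X \<in> arr D X X"
    and comp_arr: "\<lbrakk>X \<in> obj D; Y \<in> obj D; Z \<in> obj D; f \<in> arr D X Y; g \<in> arr D Y Z\<rbrakk>
      \<Longrightarrow> g \<cdot> f \<in> arr D X Z"
    and ide_left: "\<lbrakk>X \<in> obj D; Y \<in> obj D; f \<in> arr D X Y\<rbrakk> \<Longrightarrow> ide D Y \<cdot> f = f"
    and ide_right: "\<lbrakk>X \<in> obj D; Y \<in> obj D; f \<in> arr D X Y\<rbrakk> \<Longrightarrow> f \<cdot> ide D X = f"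
    and comp_assoc: "\<lbrakk>W \<in> obj D; X \<in> obj D; Y \<in> obj D; Z \<in> obj D;
        f \<in> arr D W X; g \<in> arr D X Y; h \<in> arr D Y Z\<rbrakk>
      \<Longrightarrow> (h \<cdot> g) \<cdot> f = h \<cdot> (g \<cdot> f)"

locale additive_category = category +
  assumes hom_abelian_group: "\<lbrakk>X \<in> obj D; Y \<in> obj D\<rbrakk> \<Longrightarrow> abelian_group (hom_group D X Y)"
    and comp_plus_left: "\<lbrakk>X \<in> obj D; Y \<in> obj D; Z \<in> obj D;
        f \<in> arr D X Y; g \<in> arr D Y Z; g' \<in> arr D Y Z\<rbrakk>
      \<Longrightarrow> pls D g g' \<cdot> f = pls D (g \<cdot> f) (g' \<cdot> f)"
    and comp_plus_right: "\<lbrakk>X \<in> obj D; Y \<in> obj D; Z \<in> obj D;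
        f \<in> arr D X Y; f' \<in> arr D X Y; g \<in> arr D Y Z\<rbrakk>
      \<Longrightarrow> g \<cdot> pls D f f' = pls D (g \<cdot> f) (g \<cdot> f')"
    and zero_obj_exists: "\<exists>Z. is_zero_obj D Z"
    and biproduct_exists: "\<lbrakk>X \<in> obj D; Y \<in> obj D\<rbrakk> \<Longrightarrow>
      \<exists>P\<in>obj D. \<exists>i\<in>arr D X P. \<exists>j\<in>arr D Y P. \<exists>p\<in>arr D P X. \<exists>q\<in>arr D P Y.
        p \<cdot> i = ide D X \<and> q \<cdot> j = ide D Y \<and>
        q \<cdot> i = zer D X Y \<and> p \<cdot> j = zer D Y X \<and>
        pls D (i \<cdot> p) (j \<cdot> q) = ide D P"

text \<open>The shift is an additive autoequivalence; it need not be bijective on objects.\<close>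

locale shift_category = additive_category +
  assumes shift_obj: "X \<in> obj D \<Longrightarrow> shift D X \<in> obj D"
    and shift_bij: "\<lbrakk>X \<in> obj D; Y \<in> obj D\<rbrakk> \<Longrightarrow>
      bij_betw (shiftA D) (arr D X Y) (arr D (shift D X) (shift D Y))"
    and shift_ess_surj: "Y \<in> obj D \<Longrightarrow> \<exists>X\<in>obj D. isomorphic D (shift D X) Y"
    and shift_ide: "X \<in> obj D \<Longrightarrow> shiftA D (ide D X) = ide D (shift D X)"
    and shift_comp: "\<lbrakk>X \<in> obj D; Y \<in> obj D; Z \<in> obj D; f \<in> arr D X Y; g \<in> arr D Y Z\<rbrakk>
      \<Longrightarrow> shiftA D (g \<cdot> f) = shiftA D g \<cdot> shiftA D f"
    and shift_plus: "\<lbrakk>X \<in> obj D; Y \<in> obj D; f \<in> arr D X Y; g \<in> arr D X Y\<rbrakk>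
      \<Longrightarrow> shiftA D (pls D f g) = pls D (shiftA D f) (shiftA D g)"

locale triangulated_category = shift_category +
  assumes dist_wf: "(X, Y, Z, f, g, h) \<in> tri D \<Longrightarrow>
      X \<in> obj D \<and> Y \<in> obj D \<and> Z \<in> obj D \<and>
      f \<in> arr D X Y \<and> g \<in> arr D Y Z \<and> h \<in> arr D Z (shift D X)"
    and TR1_iso: "\<lbrakk>(X, Y, Z, f, g, h) \<in> tri D;
        X' \<in> obj D; Y' \<in> obj D; Z' \<in> obj D;
        f' \<in> arr D X' Y'; g' \<in> arr D Y' Z'; h' \<in> arr D Z' (shift D X');
        is_iso D X X' a; is_iso D Y Y' b; is_iso D Z Z' c;
        b \<cdot> f = f' \<cdot> a; c \<cdot> g = g' \<cdot> b; shiftA D a \<cdot> h = h' \<cdot> c\<rbrakk>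
      \<Longrightarrow> (X', Y', Z', f', g', h') \<in> tri D"
    and TR1_ide: "\<lbrakk>X \<in> obj D; is_zero_obj D Z\<rbrakk>
      \<Longrightarrow> (X, X, Z, ide D X, zer D X Z, zer D Z (shift D X)) \<in> tri D"
    and TR1_cone: "\<lbrakk>X \<in> obj D; Y \<in> obj D; f \<in> arr D X Y\<rbrakk>
      \<Longrightarrow> \<exists>Z g h. (X, Y, Z, f, g, h) \<in> tri D"
    and TR2: "\<lbrakk>X \<in> obj D; Y \<in> obj D; Z \<in> obj D;
        f \<in> arr D X Y; g \<in> arr D Y Z; h \<in> arr D Z (shift D X)\<rbrakk>
      \<Longrightarrow> (X, Y, Z, f, g, h) \<in> tri D \<longleftrightarrow>
        (Y, Z, shift D X, g, h, \<ominus>\<^bsub>hom_group D (shift D X) (shift D Y)\<^esub> shiftA D f) \<in> tri D"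
    and TR3: "\<lbrakk>(X, Y, Z, f, g, h) \<in> tri D; (X', Y', Z', f', g', h') \<in> tri D;
        a \<in> arr D X X'; b \<in> arr D Y Y'; b \<cdot> f = f' \<cdot> a\<rbrakk>
      \<Longrightarrow> \<exists>c\<in>arr D Z Z'. c \<cdot> g = g' \<cdot> b \<and> shiftA D a \<cdot> h = h' \<cdot> c"
    and TR4: "\<lbrakk>(X, Y, Z', f, i, i') \<in> tri D; (Y, Z, X', g, j, j') \<in> tri D;
        (X, Z, Y', g \<cdot> f, k, k') \<in> tri D\<rbrakk>
      \<Longrightarrow> \<exists>u\<in>arr D Z' Y'. \<exists>v\<in>arr D Y' X'.
        (Z', Y', X', u, v, shiftA D i \<cdot> j') \<in> tri D \<and>
        u \<cdot> i = k \<cdot> g \<and> k' \<cdot> u = i' \<and> v \<cdot> k = j \<and> j' \<cdot> v = shiftA D f \<cdot> k'"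

text \<open>Strictly full subcategories are given by their classes of objects.\<close>

definition iso_closed :: "('o, 'u, 'z) tricat_scheme \<Rightarrow> 'o set \<Rightarrow> bool"
  where "iso_closed D S \<longleftrightarrow> (\<forall>X\<in>S. \<forall>Y\<in>obj D. isomorphic D X Y \<longrightarrow> Y \<in> S)"

definition triangulated_subcategory :: "('o, 'u, 'z) tricat_scheme \<Rightarrow> 'o set \<Rightarrow> bool"
  where "triangulated_subcategory D S \<longleftrightarrow>
    S \<subseteq> obj D \<and> S \<noteq> {} \<and> iso_closed D S \<and>
    (\<forall>X\<in>obj D. X \<in> S \<longleftrightarrow> shift D X \<in> S) \<and>
    (\<forall>X Y Z f g h. (X, Y, Z, f, g, h) \<in> tri D \<and> X \<in> S \<and> Y \<in> S \<longrightarrow> Z \<in> S)"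

definition orth :: "('o, 'u, 'z) tricat_scheme \<Rightarrow> 'o \<Rightarrow> 'o \<Rightarrow> bool"
  where "orth D X Y \<longleftrightarrow> arr D X Y = {zer D X Y}"

definition right_orth :: "('o, 'u, 'z) tricat_scheme \<Rightarrow> 'o set \<Rightarrow> 'o set"
  where "right_orth D S = {Y \<in> obj D. \<forall>X\<in>S. orth D X Y}"

text \<open>The classes \<open>S[1]\<close> and \<open>S[-1]\<close>, closed under isomorphism.\<close>

definition shift_up :: "('o, 'u, 'z) tricat_scheme \<Rightarrow> 'o set \<Rightarrow> 'o set"
  where "shift_up D S = {Y \<in> obj D. \<exists>X\<in>S. isomorphic D (shift D X) Y}"

definition shift_down :: "('o, 'u, 'z) tricat_scheme \<Rightarrow> 'o set \<Rightarrow> 'o set"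
  where "shift_down D S = {Y \<in> obj D. \<exists>X\<in>S. isomorphic D (shift D Y) X}"

definition retract_closed_in :: "('o, 'u, 'z) tricat_scheme \<Rightarrow> 'o set \<Rightarrow> 'o set \<Rightarrow> bool"
  where "retract_closed_in D C S \<longleftrightarrow>
    (\<forall>Y\<in>S. \<forall>X\<in>C. (\<exists>i\<in>arr D X Y. \<exists>p\<in>arr D Y X. p \<cdot>\<^bsub>D\<^esub> i = ide D X) \<longrightarrow> X \<in> S)"

definition weight_structure ::
    "('o, 'u, 'z) tricat_scheme \<Rightarrow> 'o set \<Rightarrow> 'o set \<Rightarrow> 'o set \<Rightarrow> bool"
  where "weight_structure D C wle wge \<longleftrightarrow>
    wle \<subseteq> C \<and> wge \<subseteq> C \<and>
    retract_closed_in D C wle \<and> retract_closed_in D C wge \<and>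
    wle \<subseteq> shift_up D wle \<and> shift_up D wge \<subseteq> wge \<and>
    (\<forall>X\<in>wle. \<forall>Y\<in>shift_up D wge. orth D X Y) \<and>
    (\<forall>M\<in>C. \<exists>L\<in>wle. \<exists>R'\<in>shift_up D wge. \<exists>f g h. (L, M, R', f, g, h) \<in> tri D)"

definition t_structure ::
    "('o, 'u, 'z) tricat_scheme \<Rightarrow> 'o set \<Rightarrow> 'o set \<Rightarrow> 'o set \<Rightarrow> bool"
  where "t_structure D C tle tge \<longleftrightarrow>
    tle \<subseteq> C \<and> tge \<subseteq> C \<and> iso_closed D tle \<and> iso_closed D tge \<and>
    tle \<subseteq> shift_up D tle \<and> shift_up D tge \<subseteq> tge \<and>
    (\<forall>X\<in>shift_up D tge. \<forall>Y\<in>tle. orth D X Y) \<and>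
    (\<forall>M\<in>C. \<exists>L\<in>tge. \<exists>R'\<in>shift_down D tle. \<exists>f g h. (L, M, R', f, g, h) \<in> tri D)"

definition t_restricts ::
    "('o, 'u, 'z) tricat_scheme \<Rightarrow> 'o set \<Rightarrow> 'o set \<Rightarrow> 'o set \<Rightarrow> bool"
  where "t_restricts D C'' tle tge \<longleftrightarrow> t_structure D C'' (tle \<inter> C'') (tge \<inter> C'')"

text \<open>The objects of the heart of a t-structure or a weight structure.\<close>

definition heart :: "'o set \<Rightarrow> 'o set \<Rightarrow> 'o set"
  where "heart S T = S \<inter> T"

definition strictly_orthogonal ::
    "('o, 'u, 'z) tricat_scheme \<Rightarrow> 'o set \<Rightarrow> 'o set \<Rightarrow> 'o set \<Rightarrow> 'o set \<Rightarrow> 'o set \<Rightarrow> bool"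
  where "strictly_orthogonal D wle wge C tle tge \<longleftrightarrow>
    shift_up D tge = right_orth D wle \<inter> C \<and>
    shift_down D tle = right_orth D wge \<inter> C"


section \<open>Linear structures and the subcategories cut out by classes of modules\<close>

text \<open>
  \<open>sm r f\<close> is the product of the scalar \<open>r\<close> and the arrow \<open>f\<close>, for arrows between objects of
  \<open>C0\<close>. As usual for an \<open>R\<close>-linear triangulated category, the shift is \<open>R\<close>-linear, too.
\<close>

definition linear_subcategory ::
    "('r, 'm) ring_scheme \<Rightarrow> ('o, 'u, 'z) tricat_scheme \<Rightarrow> 'o set \<Rightarrow> ('r \<Rightarrow> 'u \<Rightarrow> 'u) \<Rightarrow> bool"
  where "linear_subcategory R D C0 sm \<longleftrightarrow>
    (\<forall>X\<in>C0. \<forall>Y\<in>C0. module R (ring.extend (hom_group D X Y) (module.fields sm))) \<and>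
    (\<forall>r\<in>carrier R. \<forall>X\<in>C0. \<forall>Y\<in>C0. \<forall>Z\<in>C0. \<forall>f\<in>arr D X Y. \<forall>g\<in>arr D Y Z.
      sm r g \<cdot>\<^bsub>D\<^esub> f = sm r (g \<cdot>\<^bsub>D\<^esub> f) \<and> g \<cdot>\<^bsub>D\<^esub> sm r f = sm r (g \<cdot>\<^bsub>D\<^esub> f)) \<and>
    (\<forall>r\<in>carrier R. \<forall>X\<in>C0. \<forall>Y\<in>C0. \<forall>f\<in>arr D X Y. shiftA D (sm r f) = sm r (shiftA D f))"

text \<open>The \<open>R\<close>-module of arrows from \<open>M\<close> in \<open>C0\<close> to an arbitrary object \<open>N\<close>.\<close>

definition hom_module ::
    "('o, 'u, 'z) tricat_scheme \<Rightarrow> ('r \<Rightarrow> 'u \<Rightarrow> 'u) \<Rightarrow> 'o \<Rightarrow> 'o \<Rightarrow> ('r, 'u) module"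
  where "hom_module D sm M N =
    ring.extend (hom_group D M N) (module.fields (\<lambda>r f. f \<cdot>\<^bsub>D\<^esub> sm r (ide D M)))"

text \<open>
  Arrows of \<open>D\<close> and elements of modules share the type \<open>'u\<close>, so that the hom modules are themselves
  objects of R-Mod. The condition only concerns modules with carrier inside some hom set, so
  allowing larger modules in \<open>A\<close> would not change the resulting class.
\<close>

definition subcat_of_modules ::
    "('o, 'u, 'z) tricat_scheme \<Rightarrow> ('r \<Rightarrow> 'u \<Rightarrow> 'u) \<Rightarrow> 'o set \<Rightarrow> 'o set \<Rightarrow>
     ('r, 'u) module set \<Rightarrow> 'o set"
  where "subcat_of_modules D sm C0 C A = {N \<in> C. \<forall>M\<in>C0. hom_module D sm M N \<in> A}"

end

theory Submission
  imports "HOL-Algebra.Free_Abelian_Groups" Defs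
begin

text \<open>
  Write \<open>Hom(M, N)\<close> for the \<open>R\<close>-module of arrows from \<open>M\<close> in \<open>C0\<close> to \<open>N\<close>, and call a module small if
  it belongs to the weak Serre subcategory \<open>A\<close>. All statements about \<open>C_A\<close> come from two facts: a
  distinguished triangle in either argument of \<open>Hom\<close> gives an exact sequence of \<open>R\<close>-modules, and in
  an exact sequence of five modules the middle one is small as soon as the other four are
  (\<open>weak_serre_five\<close>).

  The five-term principle applied to \<open>Hom(M, -)\<close> shows directly that \<open>C_A\<close> is closed under cones, so
  that it is triangulated (\<open>triangulated_CA\<close>).

  The real content is that the truncation \<open>L\<close> of an object \<open>N\<close> of \<open>C_A\<close> is again in \<open>C_A\<close>, where
  \<open>L \<rightarrow> N \<rightarrow> Q \<rightarrow> L[1]\<close> has \<open>L\<close> in \<open>tge\<close> and \<open>Q\<close> in \<open>tle[-1]\<close>. Orthogonality says that there are no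
  nonzero arrows from \<open>wge\<close> to \<open>Q\<close>, nor from \<open>wle\<close> to \<open>L[1]\<close>. By the first half,
  \<open>Hom(P, L[1]) = Hom(P, N[1])\<close> is small for \<open>P\<close> in \<open>wge[1]\<close>. By the second half such \<open>P\<close> suffice: a
  weight decomposition \<open>K \<rightarrow> M \<rightarrow> P \<rightarrow> K[1]\<close> makes \<open>Hom(M, L[1])\<close> the cokernel of
  \<open>Hom(K[1], L[1]) \<rightarrow> Hom(P, L[1])\<close>, and for the same reason \<open>Hom(K[1], L[1])\<close> is a quotient of some
  \<open>Hom(P', L[1])\<close>; hence \<open>Hom(M, L[1])\<close> is a cokernel of an arrow between small modules
  (\<open>CA_if_hom_wge\<close>, \<open>CA_truncation\<close>).

  For the heart the argument is dual, once more two steps of a resolution. If \<open>N\<close> is in the heart of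
  \<open>t\<close>, there are no nonzero arrows from \<open>wge[1]\<close> to \<open>N\<close>. An object \<open>P\<close> of \<open>wge\<close> fits in a triangle
  \<open>P' \<rightarrow> H \<rightarrow> P \<rightarrow> P'[1]\<close> with \<open>P'\<close> in \<open>wge\<close> and \<open>H\<close> in the heart of the weight structure
  (\<open>heart_approximation\<close>), so \<open>Hom(P, N)\<close> is the kernel of \<open>Hom(H, N) \<rightarrow> Hom(P', N)\<close>, and \<open>Hom(P', N)\<close> embeds
  into another \<open>Hom(H', N)\<close>. So smallness on the heart of the weight structure implies smallness on
  \<open>wge\<close>, and therefore everywhere (\<open>CA_if_hom_heart\<close>).

  For modules with fewer than \<open>\<beta>\<close> generators, closure under quotients and extensions is elementary,
  and kernels are submodules. Over a Noetherian ring, submodules of finitely generated modules are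
  finitely generated; a submodule of a module generated by an infinite set \<open>S\<close> is the union of its
  intersections with the submodules generated by the finite subsets of \<open>S\<close>, and there are only
  \<open>|S|\<close> many of those (\<open>noetherian_submodule_generators\<close>).
\<close>

section \<open>Module homomorphisms\<close>

lemma module_homI:
  assumes "\<And>x. x \<in> carrier M \<Longrightarrow> f x \<in> carrier N"
    and "\<And>x y. \<lbrakk>x \<in> carrier M; y \<in> carrier M\<rbrakk> \<Longrightarrow> f (x \<oplus>\<^bsub>M\<^esub> y) = f x \<oplus>\<^bsub>N\<^esub> f y"
    and "\<And>r x. \<lbrakk>r \<in> carrier R; x \<in> carrier M\<rbrakk> \<Longrightarrow> f (r \<odot>\<^bsub>M\<^esub> x) = r \<odot>\<^bsub>N\<^esub> f x"
  shows "f \<in> module_hom R M N"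
  using assms by (auto simp: module_hom_def hom_def)

lemma module_hom_closed: "\<lbrakk>f \<in> module_hom R M N; x \<in> carrier M\<rbrakk> \<Longrightarrow> f x \<in> carrier N"
  by (auto simp: module_hom_def hom_def)

lemma module_hom_add:
  "\<lbrakk>f \<in> module_hom R M N; x \<in> carrier M; y \<in> carrier M\<rbrakk> \<Longrightarrow> f (x \<oplus>\<^bsub>M\<^esub> y) = f x \<oplus>\<^bsub>N\<^esub> f y"
  by (auto simp: module_hom_def hom_def)

lemma module_hom_smult:
  "\<lbrakk>f \<in> module_hom R M N; r \<in> carrier R; x \<in> carrier M\<rbrakk> \<Longrightarrow> f (r \<odot>\<^bsub>M\<^esub> x) = r \<odot>\<^bsub>N\<^esub> f x"
  by (auto simp: module_hom_def)

lemma module_hom_id: "id \<in> module_hom R M M"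
  by (rule module_homI) auto

lemma module_hom_comp:
  assumes "f \<in> module_hom R M N" "g \<in> module_hom R N P"
  shows "g \<circ> f \<in> module_hom R M P"
  using assms by (intro module_homI)
    (simp_all add: module_hom_closed module_hom_add module_hom_smult)

lemma module_hom_group_hom:
  assumes "module R M" "module R N" "f \<in> module_hom R M N"
  shows "group_hom (add_monoid M) (add_monoid N) f"
proof -
  interpret M: module R M by fact
  interpret N: module R N by fact
  show ?thesis
    using assms(3) by unfold_locales (auto simp: module_hom_def)
qed

lemma module_hom_zero:
  assumes "module R M" "module R N" "f \<in> module_hom R M N"
  shows "f \<zero>\<^bsub>M\<^esub> = \<zero>\<^bsub>N\<^esub>"
  using group_hom.hom_one[OF module_hom_group_hom[OF assms]] by simp

lemma module_hom_neg:
  assumes "module R M" "module R N" "f \<in> module_hom R M N" "x \<in> carrier M"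
  shows "f (\<ominus>\<^bsub>M\<^esub> x) = \<ominus>\<^bsub>N\<^esub> f x"
  using group_hom.hom_inv[OF module_hom_group_hom[OF assms(1-3)]] assms(4)
  by (simp add: a_inv_def)

lemma mem_a_kernel: "x \<in> a_kernel M N f \<longleftrightarrow> x \<in> carrier M \<and> f x = \<zero>\<^bsub>N\<^esub>"
  by (simp add: a_kernel_def kernel_def)

lemma module_hom_inj:
  assumes "module R M" "module R N" "f \<in> module_hom R M N"
    and "\<And>x. \<lbrakk>x \<in> carrier M; f x = \<zero>\<^bsub>N\<^esub>\<rbrakk> \<Longrightarrow> x = \<zero>\<^bsub>M\<^esub>"
  shows "inj_on f (carrier M)"
proof (rule inj_onI)
  interpret M: module R M by fact
  interpret N: module R N by fact
  fix x y assume xy: "x \<in> carrier M" "y \<in> carrier M" "f x = f y"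
  have "f (x \<oplus>\<^bsub>M\<^esub> \<ominus>\<^bsub>M\<^esub> y) = \<zero>\<^bsub>N\<^esub>"
    using xy assms by (simp add: module_hom_add module_hom_neg module_hom_closed N.r_neg)
  then have "x \<ominus>\<^bsub>M\<^esub> y = \<zero>\<^bsub>M\<^esub>"
    using assms(4)[of "x \<ominus>\<^bsub>M\<^esub> y"] xy by (simp add: M.minus_eq)
  moreover have "x = (x \<ominus>\<^bsub>M\<^esub> y) \<oplus>\<^bsub>M\<^esub> y"
    using xy by (simp add: M.minus_eq M.a_assoc M.l_neg)
  ultimately show "x = y" using xy by simp
qed

lemma submodule_image:
  assumes "module R M" "module R N" "f \<in> module_hom R M N"
  shows "submodule (f ` carrier M) R N"
proof -
  interpret M: module R M by fact
  interpret N: module R N by fact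
  show ?thesis
  proof (rule N.submoduleI)
    show "\<zero>\<^bsub>N\<^esub> \<in> f ` carrier M"
      using module_hom_zero[OF assms] by (metis M.zero_closed imageI)
    fix a assume "a \<in> f ` carrier M"
    then obtain x where x: "x \<in> carrier M" "a = f x" by auto
    then have "\<ominus>\<^bsub>N\<^esub> a = f (\<ominus>\<^bsub>M\<^esub> x)" by (simp add: module_hom_neg[OF assms])
    then show "\<ominus>\<^bsub>N\<^esub> a \<in> f ` carrier M" using x by blast
  next
    fix r a assume "r \<in> carrier R" "a \<in> f ` carrier M"
    then obtain x where x: "r \<in> carrier R" "x \<in> carrier M" "a = f x" by auto
    then have "r \<odot>\<^bsub>N\<^esub> a = f (r \<odot>\<^bsub>M\<^esub> x)" by (simp add: module_hom_smult[OF assms(3)])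
    then show "r \<odot>\<^bsub>N\<^esub> a \<in> f ` carrier M" using x by blast
  next
    fix a b assume "a \<in> f ` carrier M" "b \<in> f ` carrier M"
    then obtain x y where xy: "x \<in> carrier M" "a = f x" "y \<in> carrier M" "b = f y" by auto
    then have "a \<oplus>\<^bsub>N\<^esub> b = f (x \<oplus>\<^bsub>M\<^esub> y)" by (simp add: module_hom_add[OF assms(3)])
    then show "a \<oplus>\<^bsub>N\<^esub> b \<in> f ` carrier M" using xy by blast
  qed (use module_hom_closed[OF assms(3)] in auto)
qed

lemma module_range:
  assumes "module R M" "module R N" "f \<in> module_hom R M N"
  shows "module R (N\<lparr>carrier := f ` carrier M\<rparr>)"
  using submodule.submodule_is_module[OF submodule_image[OF assms] assms(2)] .


section \<open>Exactness properties of weak Serre subcategories\<close>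

lemma weak_serreD:
  assumes "weak_serre R A"
  shows "A \<noteq> {}"
    and "\<And>M. M \<in> A \<Longrightarrow> module R M"
    and "\<And>M N. \<lbrakk>M \<in> A; module R N; module_isomorphic R M N\<rbrakk> \<Longrightarrow> N \<in> A"
    and "\<And>M N f K i. \<lbrakk>M \<in> A; N \<in> A; f \<in> module_hom R M N; is_module_kernel R M N f K i\<rbrakk> \<Longrightarrow> K \<in> A"
    and "\<And>M N f Q q. \<lbrakk>M \<in> A; N \<in> A; f \<in> module_hom R M N; is_module_cokernel R M N f Q q\<rbrakk> \<Longrightarrow> Q \<in> A"
    and "\<And>K Q E i q. \<lbrakk>K \<in> A; Q \<in> A; short_exact R K E Q i q\<rbrakk> \<Longrightarrow> E \<in> A"
proof -
  note A = assms[unfolded weak_serre_def]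
  show "A \<noteq> {}" using A[THEN conjunct1] .
  show "module R M" if "M \<in> A" for M
    using A[THEN conjunct2, THEN conjunct1] that by blast
  show "N \<in> A" if "M \<in> A" "module R N" "module_isomorphic R M N" for M N
    using A[THEN conjunct2, THEN conjunct2, THEN conjunct1] that by blast
  show "K \<in> A" if "M \<in> A" "N \<in> A" "f \<in> module_hom R M N" "is_module_kernel R M N f K i"
    for M N f K i
    using A[THEN conjunct2, THEN conjunct2, THEN conjunct2, THEN conjunct1] that by blast
  show "Q \<in> A" if "M \<in> A" "N \<in> A" "f \<in> module_hom R M N" "is_module_cokernel R M N f Q q"
    for M N f Q q
    using A[THEN conjunct2, THEN conjunct2, THEN conjunct2, THEN conjunct2, THEN conjunct1] that
    by blast
  show "E \<in> A" if "K \<in> A" "Q \<in> A" "short_exact R K E Q i q" for K Q E i q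
    using A[THEN conjunct2, THEN conjunct2, THEN conjunct2, THEN conjunct2, THEN conjunct2] that
    by blast
qed

lemmas weak_serre_module = weak_serreD(2)

lemma weak_serre_iso:
  assumes "weak_serre R A" "M \<in> A" "module R N" "f \<in> module_hom R M N"
    and "bij_betw f (carrier M) (carrier N)"
  shows "N \<in> A"
  using weak_serreD(3)[OF assms(1-3)] assms(4,5) unfolding module_isomorphic_def by blast

text \<open>
  A weak Serre subcategory is only assumed to contain kernels of arrows between its own objects. The
  target of \<open>u\<close> may nevertheless be an arbitrary submodule of an object of \<open>A\<close>: composing with the
  embedding \<open>j\<close> does not change the kernel.
\<close>

lemma weak_serre_kernel:
  assumes A: "weak_serre R A" and M: "M \<in> A" "M' \<in> A"
    and T: "module R T" "u \<in> module_hom R M T"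
    and j: "j \<in> module_hom R T M'" "inj_on j (carrier T)"
    and K: "module R K" "i \<in> module_hom R K M" "inj_on i (carrier K)"
    and ex: "i ` carrier K = a_kernel M T u"
  shows "K \<in> A"
proof -
  have M': "module R M'" by (rule weak_serre_module[OF A M(2)])
  interpret T: module R T by fact
  have "j t = \<zero>\<^bsub>M'\<^esub> \<longleftrightarrow> t = \<zero>\<^bsub>T\<^esub>" if "t \<in> carrier T" for t
    using that j module_hom_zero[OF T(1) M' j(1)] by (metis T.zero_closed inj_onD)
  then have "a_kernel M M' (j \<circ> u) = a_kernel M T u"
    using module_hom_closed[OF T(2)] by (auto simp: mem_a_kernel)
  then have "is_module_kernel R M M' (j \<circ> u) K i"
    using K ex by (simp add: is_module_kernel_def)
  moreover have "j \<circ> u \<in> module_hom R M M'"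
    using T(2) j(1) by (rule module_hom_comp)
  ultimately show ?thesis
    by (intro weak_serreD(4)[OF A M])
qed

text \<open>
  Dually, the source of \<open>v\<close> may be an arbitrary quotient of an object of \<open>A\<close>: composing with the
  surjection \<open>p\<close> does not change the image.
\<close>

lemma weak_serre_cokernel:
  assumes A: "weak_serre R A" and M: "M' \<in> A" "M \<in> A"
    and p: "p \<in> module_hom R M' T" "p ` carrier M' = carrier T"
    and v: "v \<in> module_hom R T M"
    and Q: "module R Q" "q \<in> module_hom R M Q" "q ` carrier M = carrier Q"
    and ex: "a_kernel M Q q = v ` carrier T"
  shows "Q \<in> A"
proof -
  have "(v \<circ> p) ` carrier M' = v ` carrier T"
    by (simp only: image_comp [symmetric] p(2))
  then have "is_module_cokernel R M' M (v \<circ> p) Q q"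
    using Q ex by (simp only: is_module_cokernel_def simp_thms)
  moreover have "v \<circ> p \<in> module_hom R M' M"
    using p(1) v by (rule module_hom_comp)
  ultimately show ?thesis
    by (intro weak_serreD(5)[OF A M])
qed

text \<open>
  A zero module is the kernel of the identity of any object of \<open>A\<close>.
\<close>

lemma weak_serre_zero:
  assumes A: "weak_serre R A" and Z: "module R Z" "carrier Z = {\<zero>\<^bsub>Z\<^esub>}"
  shows "Z \<in> A"
proof -
  obtain M where M: "M \<in> A" using weak_serreD(1)[OF A] by blast
  interpret M: module R M by (rule weak_serre_module[OF A M])
  interpret Z: module R Z by fact
  have "\<zero>\<^bsub>Z\<^esub> \<oplus>\<^bsub>Z\<^esub> \<zero>\<^bsub>Z\<^esub> = \<zero>\<^bsub>Z\<^esub>" by simp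
  then have i: "(\<lambda>_. \<zero>\<^bsub>M\<^esub>) \<in> module_hom R Z M"
    using Z(2) by (intro module_homI) auto
  show ?thesis
  proof (rule weak_serre_kernel[OF A M M M.module_axioms module_hom_id module_hom_id _ Z(1) i])
    show "(\<lambda>_. \<zero>\<^bsub>M\<^esub>) ` carrier Z = a_kernel M M id"
      using Z(2) by (auto simp: mem_a_kernel)
  qed (auto simp: Z(2))
qed

text \<open>
  The middle term is an extension of the kernel of \<open>f4\<close> by the cokernel of \<open>f1\<close>. Both are realised as
  images, inside \<open>M4\<close> and \<open>M3\<close>, so that no new carrier type is needed.
\<close>

lemma weak_serre_five:
  assumes A: "weak_serre R A" and M: "M1 \<in> A" "M2 \<in> A" "M4 \<in> A" "M5 \<in> A"
    and M3: "module R M3"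
    and f: "f1 \<in> module_hom R M1 M2" "f2 \<in> module_hom R M2 M3"
      "f3 \<in> module_hom R M3 M4" "f4 \<in> module_hom R M4 M5"
    and ex: "a_kernel M2 M3 f2 = f1 ` carrier M1" "a_kernel M3 M4 f3 = f2 ` carrier M2"
      "a_kernel M4 M5 f4 = f3 ` carrier M3"
  shows "M3 \<in> A"
proof -
  note mods = weak_serre_module[OF A M(1)] weak_serre_module[OF A M(2)]
    weak_serre_module[OF A M(3)] weak_serre_module[OF A M(4)]
  define I where "I = M3\<lparr>carrier := f2 ` carrier M2\<rparr>"
  define J where "J = M4\<lparr>carrier := f3 ` carrier M3\<rparr>"
  have I: "module R I" unfolding I_def by (rule module_range[OF mods(2) M3 f(2)])
  have J: "module R J" unfolding J_def by (rule module_range[OF M3 mods(3) f(3)])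
  have "I \<in> A"
  proof (rule weak_serre_cokernel[OF A M(1) M(2) module_hom_id _ f(1) I])
    show "f2 \<in> module_hom R M2 I"
      using f(2) by (auto simp: I_def module_hom_def hom_def)
    show "f2 ` carrier M2 = carrier I" by (simp add: I_def)
    show "a_kernel M2 I f2 = f1 ` carrier M1"
      using ex(1) by (auto simp: mem_a_kernel I_def set_eq_iff)
  qed simp
  moreover have "J \<in> A"
  proof (rule weak_serre_kernel[OF A M(3) M(4) mods(4) f(4) module_hom_id _ J])
    show "id \<in> module_hom R J M4"
      using f(3) by (auto simp: J_def module_hom_def hom_def)
    show "id ` carrier J = a_kernel M4 M5 f4" using ex(3) by (simp add: J_def)
  qed auto
  moreover have "short_exact R I M3 J id f3"
    unfolding short_exact_def
  proof (intro conjI)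
    show "id \<in> module_hom R I M3"
      using f(2) by (auto simp: I_def module_hom_def hom_def)
    show "f3 \<in> module_hom R M3 J"
      using f(3) by (auto simp: J_def module_hom_def hom_def)
    show "id ` carrier I = a_kernel M3 J f3"
      using ex(2) by (auto simp: mem_a_kernel I_def J_def set_eq_iff)
    show "f3 ` carrier M3 = carrier J" by (simp add: J_def)
  qed (use I J M3 in auto)
  ultimately show ?thesis
    by (rule weak_serreD(6)[OF A])
qed

text \<open>
  Closure under isomorphism is stated along arrows out of objects of \<open>A\<close>. For the converse, the inverse
  of \<open>f\<close> is avoided by viewing \<open>f\<close> as a kernel of the zero endomorphism of \<open>N\<close>.
\<close>

lemma weak_serre_iso_iff:
  assumes A: "weak_serre R A" and MN: "module R M" "module R N"
    and f: "f \<in> module_hom R M N" "bij_betw f (carrier M) (carrier N)"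
  shows "M \<in> A \<longleftrightarrow> N \<in> A"
proof
  show "N \<in> A" if "M \<in> A" by (rule weak_serre_iso[OF A that MN(2) f])
  assume N: "N \<in> A"
  interpret N: module R N by fact
  have z: "(\<lambda>_. \<zero>\<^bsub>N\<^esub>) \<in> module_hom R N N" by (rule module_homI) auto
  show "M \<in> A"
  proof (rule weak_serre_kernel[OF A N N MN(2) z module_hom_id _ MN(1) f(1)])
    show "inj_on f (carrier M)" using f(2) by (simp add: bij_betw_def)
    show "f ` carrier M = a_kernel N N (\<lambda>_. \<zero>\<^bsub>N\<^esub>)"
      using f(2) by (auto simp: bij_betw_def mem_a_kernel)
  qed simp
qed

section \<open>Generators\<close>

text \<open>
  Elements are built as sums of scaled generators; the rule \<open>step\<close> adds one summand at a time, which
  gives an induction principle with a single inductive premise.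
\<close>

inductive_set module_span ::
    "('r, 'm) ring_scheme \<Rightarrow> ('r, 'u, 'n) module_scheme \<Rightarrow> 'u set \<Rightarrow> 'u set"
  for R :: "('r, 'm) ring_scheme" and M :: "('r, 'u, 'n) module_scheme" and S :: "'u set"
  where
    zero: "\<zero>\<^bsub>M\<^esub> \<in> module_span R M S"
  | step: "\<lbrakk>r \<in> carrier R; s \<in> S; x \<in> module_span R M S\<rbrakk> \<Longrightarrow> r \<odot>\<^bsub>M\<^esub> s \<oplus>\<^bsub>M\<^esub> x \<in> module_span R M S"

lemma module_span_mono: "x \<in> module_span R M S \<Longrightarrow> S \<subseteq> T \<Longrightarrow> x \<in> module_span R M T"
  proof (induction rule: module_span.induct)
  case zero
  show ?case by (rule module_span.zero)
next
  case (step r s x)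
  then show ?case by (intro module_span.step) auto
qed

lemma module_span_finite_support: "x \<in> module_span R M S \<Longrightarrow> \<exists>F. finite F \<and> F \<subseteq> S \<and> x \<in> module_span R M F"
proof (induction rule: module_span.induct)
  case zero
  show ?case by (intro exI[of _ "{}"]) (simp add: module_span.zero)
next
  case (step r s x)
  then obtain F where F: "finite F" "F \<subseteq> S" "x \<in> module_span R M F" by blast
  from F(3) have "x \<in> module_span R M (insert s F)" by (rule module_span_mono[OF _ subset_insertI])
  then have "r \<odot>\<^bsub>M\<^esub> s \<oplus>\<^bsub>M\<^esub> x \<in> module_span R M (insert s F)"
    using step(1) by (intro module_span.step) auto
  moreover have "finite (insert s F)" "insert s F \<subseteq> S" using F step(2) by auto
  ultimately show ?case by blast
qed

context module
begin

lemma module_span_subset: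
  assumes "submodule H R M" "S \<subseteq> H"
  shows "module_span R M S \<subseteq> H"
proof
  fix x assume "x \<in> module_span R M S"
  then show "x \<in> H"
  proof (induction rule: module_span.induct)
    case zero
    show ?case using subgroup.one_closed[OF submodule.axioms(1)[OF assms(1)]] by simp
  next
    case (step r s x)
    then have "s \<in> H" using assms(2) by blast
    then show ?case using step by (intro submoduleE(4,5)[OF assms(1)])
  qed
qed

lemma module_span_carrier: "S \<subseteq> carrier M \<Longrightarrow> module_span R M S \<subseteq> carrier M"
  by (rule module_span_subset[OF carrier_is_submodule])

lemma submodule_module_span:
  assumes S: "S \<subseteq> carrier M"
  shows "submodule (module_span R M S) R M"
proof -
  have sub: "x \<in> carrier M" if "x \<in> module_span R M S" for x using module_span_carrier[OF S] that by blast
  have smult: "a \<odot>\<^bsub>M\<^esub> x \<in> module_span R M S" if "a \<in> carrier R" "x \<in> module_span R M S" for a x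
    using that(2)
  proof (induction rule: module_span.induct)
    case zero
    show ?case using that(1) by (simp add: module_span.zero)
  next
    case (step r s x)
    then have "a \<odot>\<^bsub>M\<^esub> (r \<odot>\<^bsub>M\<^esub> s \<oplus>\<^bsub>M\<^esub> x) = (a \<otimes> r) \<odot>\<^bsub>M\<^esub> s \<oplus>\<^bsub>M\<^esub> a \<odot>\<^bsub>M\<^esub> x"
      using that(1) S sub by (simp add: smult_r_distr smult_assoc1 subset_iff)
    then show ?case using step that(1) by (simp add: module_span.step)
  qed
  have add: "x \<oplus>\<^bsub>M\<^esub> y \<in> module_span R M S" if "x \<in> module_span R M S" "y \<in> module_span R M S" for x y
    using that(1)
  proof (induction rule: module_span.induct)
    case zero
    show ?case using that(2) sub by simp
  next
    case (step r s x)
    then have "(r \<odot>\<^bsub>M\<^esub> s \<oplus>\<^bsub>M\<^esub> x) \<oplus>\<^bsub>M\<^esub> y = r \<odot>\<^bsub>M\<^esub> s \<oplus>\<^bsub>M\<^esub> (x \<oplus>\<^bsub>M\<^esub> y)"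
      using S sub that(2) by (simp add: M.a_assoc subset_iff)
    then show ?case using step by (simp add: module_span.step)
  qed
  show ?thesis
  proof (rule submoduleI)
    fix a assume "a \<in> module_span R M S"
    then have "(\<ominus> \<one>) \<odot>\<^bsub>M\<^esub> a \<in> module_span R M S" by (intro smult) auto
    then show "\<ominus>\<^bsub>M\<^esub> a \<in> module_span R M S"
      using sub[OF \<open>a \<in> _\<close>] by (simp add: smult_l_minus)
  qed (use smult add sub module_span.zero in auto)
qed

lemma module_span_superset:
  assumes "S \<subseteq> carrier M"
  shows "S \<subseteq> module_span R M S"
proof
  fix s assume "s \<in> S"
  then have "\<one> \<odot>\<^bsub>M\<^esub> s \<oplus>\<^bsub>M\<^esub> \<zero>\<^bsub>M\<^esub> \<in> module_span R M S"
    by (intro module_span.intros) auto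
  then show "s \<in> module_span R M S" using assms \<open>s \<in> S\<close> by (simp add: subset_iff)
qed

end

lemma module_generates_iff_span:
  assumes "module R M"
  shows "module_generates R M S \<longleftrightarrow> S \<subseteq> carrier M \<and> module_span R M S = carrier M"
proof
  interpret module R M by fact
  assume "module_generates R M S"
  then show "S \<subseteq> carrier M \<and> module_span R M S = carrier M"
    using submodule_module_span module_span_superset by (auto simp: module_generates_def)
next
  interpret module R M by fact
  assume S: "S \<subseteq> carrier M \<and> module_span R M S = carrier M"
  then show "module_generates R M S"
    unfolding module_generates_def using module_span_subset submoduleE(1) by blast
qed

lemma module_hom_span:
  assumes MN: "module R M" "module R N" and f: "f \<in> module_hom R M N" and S: "S \<subseteq> carrier M"
  shows "f ` module_span R M S = module_span R N (f ` S)"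
proof
  interpret M: module R M by fact
  interpret N: module R N by fact
  have cl: "x \<in> carrier M" if "x \<in> module_span R M S" for x using M.module_span_carrier[OF S] that by blast
  have "f x \<in> module_span R N (f ` S)" if "x \<in> module_span R M S" for x
    using that
  proof (induction rule: module_span.induct)
    case zero
    show ?case using module_hom_zero[OF MN f] by (simp add: module_span.zero)
  next
    case (step r s x)
    then have "f (r \<odot>\<^bsub>M\<^esub> s \<oplus>\<^bsub>M\<^esub> x) = r \<odot>\<^bsub>N\<^esub> f s \<oplus>\<^bsub>N\<^esub> f x"
      using S cl f by (simp add: module_hom_add module_hom_smult subset_iff)
    then show ?case using step by (simp add: module_span.step)
  qed
  then show "f ` module_span R M S \<subseteq> module_span R N (f ` S)" by blast
  have "y \<in> f ` module_span R M S" if "y \<in> module_span R N (f ` S)" for y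
    using that
  proof (induction rule: module_span.induct)
    case zero
    show ?case using module_hom_zero[OF MN f] by (metis imageI module_span.zero)
  next
    case (step r t y)
    then obtain s x where sx: "s \<in> S" "t = f s" "x \<in> module_span R M S" "y = f x" by blast
    then have "f (r \<odot>\<^bsub>M\<^esub> s \<oplus>\<^bsub>M\<^esub> x) = r \<odot>\<^bsub>N\<^esub> t \<oplus>\<^bsub>N\<^esub> y"
      using S cl f step by (simp add: module_hom_add module_hom_smult subset_iff)
    then show ?case using sx step by (metis imageI module_span.step)
  qed
  then show "module_span R N (f ` S) \<subseteq> f ` module_span R M S" by blast
qed

section \<open>Submodules over Noetherian rings\<close>

context module
begin

lemma submodule_Int:
  assumes H: "submodule H R M" and U: "submodule U R M"
  shows "submodule (H \<inter> U) R M"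
proof -
  have "subgroup (H \<inter> U) (add_monoid M)"
    using submodule.axioms(1)[OF H] submodule.axioms(1)[OF U]
    by (rule M.add.subgroups_Inter_pair)
  then show ?thesis
    by (rule submodule.intro) (simp add: submodule_axioms_def submoduleE(4)[OF H] submoduleE(4)[OF U])
qed

text \<open>
  The module analogue of the ideal of leading coefficients in Hilbert's basis theorem: the
  coefficients of those multiples of \<open>x\<close> that agree modulo \<open>U\<close> with an element of \<open>V\<close>.
\<close>

lemma ideal_of_leading_coefficients:
  assumes U: "submodule U R M" and V: "submodule V R M" and x: "x \<in> carrier M"
  shows "ideal {r \<in> carrier R. \<exists>y\<in>U. r \<odot>\<^bsub>M\<^esub> x \<oplus>\<^bsub>M\<^esub> y \<in> V} R"
proof -
  let ?I = "{r \<in> carrier R. \<exists>y\<in>U. r \<odot>\<^bsub>M\<^esub> x \<oplus>\<^bsub>M\<^esub> y \<in> V}"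
  have memI: "r \<in> ?I" if "r \<in> carrier R" "y \<in> U" "r \<odot>\<^bsub>M\<^esub> x \<oplus>\<^bsub>M\<^esub> y \<in> V" for r y
    using that by blast
  have U0: "\<zero>\<^bsub>M\<^esub> \<in> U" using subgroup.one_closed[OF submodule.axioms(1)[OF U]] by simp
  have V0: "\<zero>\<^bsub>M\<^esub> \<in> V" using subgroup.one_closed[OF submodule.axioms(1)[OF V]] by simp
  have Uc: "y \<in> carrier M" if "y \<in> U" for y using submoduleE(1)[OF U] that by blast
  have mult: "s \<otimes> r \<in> ?I" if r: "r \<in> ?I" and s: "s \<in> carrier R" for r s
  proof -
    obtain y where y: "y \<in> U" "r \<odot>\<^bsub>M\<^esub> x \<oplus>\<^bsub>M\<^esub> y \<in> V" using r by blast
    have "(s \<otimes> r) \<odot>\<^bsub>M\<^esub> x \<oplus>\<^bsub>M\<^esub> s \<odot>\<^bsub>M\<^esub> y = s \<odot>\<^bsub>M\<^esub> (r \<odot>\<^bsub>M\<^esub> x \<oplus>\<^bsub>M\<^esub> y)"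
      using r s x Uc[OF y(1)] by (simp add: smult_r_distr smult_assoc1)
    then show ?thesis
      using r s submoduleE(4)[OF U s y(1)] submoduleE(4)[OF V s y(2)]
      by (intro memI[of _ "s \<odot>\<^bsub>M\<^esub> y"]) auto
  qed
  have add: "r \<oplus> s \<in> ?I" if rs: "r \<in> ?I" "s \<in> ?I" for r s
  proof -
    obtain y z where y: "y \<in> U" "r \<odot>\<^bsub>M\<^esub> x \<oplus>\<^bsub>M\<^esub> y \<in> V" and z: "z \<in> U" "s \<odot>\<^bsub>M\<^esub> x \<oplus>\<^bsub>M\<^esub> z \<in> V"
      using rs by blast
    have "(r \<oplus> s) \<odot>\<^bsub>M\<^esub> x \<oplus>\<^bsub>M\<^esub> (y \<oplus>\<^bsub>M\<^esub> z) = (r \<odot>\<^bsub>M\<^esub> x \<oplus>\<^bsub>M\<^esub> y) \<oplus>\<^bsub>M\<^esub> (s \<odot>\<^bsub>M\<^esub> x \<oplus>\<^bsub>M\<^esub> z)"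
      using rs x Uc[OF y(1)] Uc[OF z(1)] by (simp add: smult_l_distr M.a_ac)
    then show ?thesis
      using rs submoduleE(5)[OF U y(1) z(1)] submoduleE(5)[OF V y(2) z(2)]
      by (intro memI[of _ "y \<oplus>\<^bsub>M\<^esub> z"]) auto
  qed
  show ?thesis
  proof (rule idealI)
    show "ring R" by (rule R.ring_axioms)
    show "subgroup ?I (add_monoid R)"
    proof (rule R.add.subgroupI)
      have "\<zero> \<in> ?I" by (rule memI[OF R.zero_closed U0]) (use V0 x in simp)
      then show "?I \<noteq> {}" by blast
      fix r assume r: "r \<in> ?I"
      have "(\<ominus> \<one>) \<otimes> r \<in> ?I" by (rule mult[OF r]) simp
      then show "\<ominus> r \<in> ?I" using r by (simp add: R.l_minus)
    qed (use add in auto)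
    fix r s assume r: "r \<in> ?I" and s: "s \<in> carrier R"
    show "s \<otimes> r \<in> ?I" by (rule mult[OF r s])
    then show "r \<otimes> s \<in> ?I" using r s by (simp add: R.m_comm)
  qed
qed

lemma module_span_insertE:
  assumes z: "z \<in> module_span R M (insert x F)" and x: "x \<in> carrier M" and F: "F \<subseteq> carrier M"
  obtains r y where "r \<in> carrier R" "y \<in> module_span R M F" "z = r \<odot>\<^bsub>M\<^esub> x \<oplus>\<^bsub>M\<^esub> y"
proof -
  have "\<exists>r\<in>carrier R. \<exists>y\<in>module_span R M F. z = r \<odot>\<^bsub>M\<^esub> x \<oplus>\<^bsub>M\<^esub> y"
    using z
  proof (induction rule: module_span.induct)
    case zero
    have "\<zero>\<^bsub>M\<^esub> = \<zero> \<odot>\<^bsub>M\<^esub> x \<oplus>\<^bsub>M\<^esub> \<zero>\<^bsub>M\<^esub>" using x by simp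
    then show ?case using module_span.zero[of M R F] R.zero_closed by blast
  next
    case (step r s w)
    then obtain r' y where ry: "r' \<in> carrier R" "y \<in> module_span R M F" "w = r' \<odot>\<^bsub>M\<^esub> x \<oplus>\<^bsub>M\<^esub> y"
      by blast
    have y: "y \<in> carrier M" using ry(2) module_span_carrier[OF F] by blast
    show ?case
    proof (cases "s = x")
      case True
      have "r \<odot>\<^bsub>M\<^esub> s \<oplus>\<^bsub>M\<^esub> w = (r \<oplus> r') \<odot>\<^bsub>M\<^esub> x \<oplus>\<^bsub>M\<^esub> y"
        using True ry y x step(1) by (simp add: smult_l_distr M.a_assoc)
      then show ?thesis using ry step(1) R.a_closed by blast
    next
      case False
      then have s: "s \<in> F" using step(2) by blast
      have "r \<odot>\<^bsub>M\<^esub> s \<oplus>\<^bsub>M\<^esub> w = r' \<odot>\<^bsub>M\<^esub> x \<oplus>\<^bsub>M\<^esub> (r \<odot>\<^bsub>M\<^esub> s \<oplus>\<^bsub>M\<^esub> y)"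
        using s F ry y x step(1) by (simp add: M.a_lcomm subset_iff)
      then show ?thesis using ry(1) module_span.step[OF step(1) s ry(2)] by blast
    qed
  qed
  then show ?thesis using that by blast
qed

text \<open>
  Induction on the number of generators of the ambient module. Lifts to \<open>H\<close> of finitely many
  generators of the ideal of coefficients of \<open>x\<close> reduce every element of \<open>H\<close> to one without an
  \<open>x\<close>-part, that is, to the intersection of \<open>H\<close> with the module generated by \<open>F\<close>.
\<close>

lemma noetherian_submodule_finitely_generated:
  assumes noeth: "noetherian_ring R" and "finite F" "F \<subseteq> carrier M"
    and "submodule H R M" "H \<subseteq> module_span R M F"
  shows "\<exists>T. finite T \<and> T \<subseteq> H \<and> H \<subseteq> module_span R M T"
  using assms(2-)
proof (induction F arbitrary: H rule: finite_induct)
  case empty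
  show ?case using empty.prems(3) by (intro exI[of _ "{}"]) simp
next
  case (insert x F H)
  have x: "x \<in> carrier M" and F: "F \<subseteq> carrier M" using insert.prems by auto
  let ?U = "module_span R M F"
  have U: "submodule ?U R M" by (rule submodule_module_span[OF F])
  have Hc: "H \<subseteq> carrier M" by (rule submoduleE(1)[OF insert.prems(2)])
  have HU: "submodule (H \<inter> ?U) R M" by (rule submodule_Int[OF insert.prems(2) U])
  obtain T' where T': "finite T'" "T' \<subseteq> H \<inter> ?U" "H \<inter> ?U \<subseteq> module_span R M T'"
    using insert.IH[OF F HU Int_lower2] by blast
  let ?I = "\<lambda>V. {r \<in> carrier R. \<exists>y\<in>?U. r \<odot>\<^bsub>M\<^esub> x \<oplus>\<^bsub>M\<^esub> y \<in> V}"
  obtain B where B: "B \<subseteq> carrier R" "finite B" "?I H = Idl B"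
    using noetherian_ring.finetely_gen[OF noeth ideal_of_leading_coefficients[OF U insert.prems(2) x]]
    by blast
  have "\<forall>b\<in>B. \<exists>y\<in>?U. b \<odot>\<^bsub>M\<^esub> x \<oplus>\<^bsub>M\<^esub> y \<in> H"
    using R.genideal_self[OF B(1)] B(3) by blast
  then obtain c where c: "\<And>b. b \<in> B \<Longrightarrow> c b \<in> ?U" "\<And>b. b \<in> B \<Longrightarrow> b \<odot>\<^bsub>M\<^esub> x \<oplus>\<^bsub>M\<^esub> c b \<in> H"
    by metis
  \<comment> \<open>\<open>T'\<close> generates the elements of \<open>H\<close> without an \<open>x\<close>-part, the lifts reduce to them.\<close>
  define T where "T = T' \<union> (\<lambda>b. b \<odot>\<^bsub>M\<^esub> x \<oplus>\<^bsub>M\<^esub> c b) ` B"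
  have TH: "T \<subseteq> H" using T' c by (auto simp: T_def)
  then have Tc: "T \<subseteq> carrier M" using Hc by blast
  have V: "submodule (module_span R M T) R M" by (rule submodule_module_span[OF Tc])
  have spTH: "module_span R M T \<subseteq> H" by (rule module_span_subset[OF insert.prems(2) TH])
  have "b \<odot>\<^bsub>M\<^esub> x \<oplus>\<^bsub>M\<^esub> c b \<in> module_span R M T" if "b \<in> B" for b
    using module_span_superset[OF Tc] that by (auto simp: T_def)
  then have "B \<subseteq> ?I (module_span R M T)"
    using B(1) c(1) by blast
  then have I: "?I H \<subseteq> ?I (module_span R M T)"
    unfolding B(3) by (rule R.genideal_minimal[OF ideal_of_leading_coefficients[OF U V x]])
  have "z \<in> module_span R M T" if z: "z \<in> H" for z
  proof -
    have "z \<in> module_span R M (insert x F)" using z insert.prems(3) by blast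
    then obtain r y where ry: "r \<in> carrier R" "y \<in> ?U" "z = r \<odot>\<^bsub>M\<^esub> x \<oplus>\<^bsub>M\<^esub> y"
      by (rule module_span_insertE[OF _ x F])
    then have "r \<in> ?I H" using z by blast
    then obtain y' where y': "y' \<in> ?U" "r \<odot>\<^bsub>M\<^esub> x \<oplus>\<^bsub>M\<^esub> y' \<in> module_span R M T"
      using I by blast
    let ?w = "r \<odot>\<^bsub>M\<^esub> x \<oplus>\<^bsub>M\<^esub> y'"
    have yc: "y \<in> carrier M" "y' \<in> carrier M" using ry(2) y'(1) submoduleE(1)[OF U] by auto
    have "z \<oplus>\<^bsub>M\<^esub> \<ominus>\<^bsub>M\<^esub> ?w = (r \<odot>\<^bsub>M\<^esub> x \<oplus>\<^bsub>M\<^esub> \<ominus>\<^bsub>M\<^esub> (r \<odot>\<^bsub>M\<^esub> x)) \<oplus>\<^bsub>M\<^esub> (y \<oplus>\<^bsub>M\<^esub> \<ominus>\<^bsub>M\<^esub> y')"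
      unfolding ry(3) using ry(1) x yc by (simp add: M.minus_add M.a_ac)
    then have diff: "y \<oplus>\<^bsub>M\<^esub> \<ominus>\<^bsub>M\<^esub> y' = z \<oplus>\<^bsub>M\<^esub> \<ominus>\<^bsub>M\<^esub> ?w"
      using ry(1) x yc by (simp add: M.r_neg)
    have "y \<oplus>\<^bsub>M\<^esub> \<ominus>\<^bsub>M\<^esub> y' \<in> ?U"
      by (rule submoduleE(5)[OF U ry(2) submoduleE(3)[OF U y'(1)]])
    moreover have "z \<oplus>\<^bsub>M\<^esub> \<ominus>\<^bsub>M\<^esub> ?w \<in> H"
      by (rule submoduleE(5)[OF insert.prems(2) z submoduleE(3)[OF insert.prems(2) subsetD[OF spTH y'(2)]]])
    ultimately have "z \<oplus>\<^bsub>M\<^esub> \<ominus>\<^bsub>M\<^esub> ?w \<in> module_span R M T'"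
      using T'(3) diff by auto
    then have "z \<oplus>\<^bsub>M\<^esub> \<ominus>\<^bsub>M\<^esub> ?w \<in> module_span R M T"
      by (rule module_span_mono) (simp add: T_def)
    then have "(z \<oplus>\<^bsub>M\<^esub> \<ominus>\<^bsub>M\<^esub> ?w) \<oplus>\<^bsub>M\<^esub> ?w \<in> module_span R M T"
      using y'(2) by (rule submoduleE(5)[OF V])
    moreover have "(z \<oplus>\<^bsub>M\<^esub> \<ominus>\<^bsub>M\<^esub> ?w) \<oplus>\<^bsub>M\<^esub> ?w = z"
      using subsetD[OF Hc z] yc(2) ry(1) x by (simp add: M.a_assoc M.l_neg del: M.minus_add)
    ultimately show ?thesis by simp
  qed
  then have "H \<subseteq> module_span R M T" by blast
  moreover have "finite T" using T'(1) B(2) by (simp add: T_def)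
  ultimately show ?case using TH by blast
qed

text \<open>
  For infinite \<open>S\<close>, finitely many generators are chosen for the intersection of \<open>H\<close> with the span of each
  finite subset of \<open>S\<close>. An element of \<open>H\<close> involves only finitely many elements of \<open>S\<close>, so these
  generators together generate \<open>H\<close>, and \<open>S\<close> has only \<open>|S|\<close> many finite subsets.
\<close>

lemma noetherian_submodule_generators:
  assumes noeth: "noetherian_ring R" and S: "S \<subseteq> carrier M" "module_span R M S = carrier M"
    and H: "submodule H R M" and \<beta>: "Cinfinite \<beta>" "(card_of S, \<beta>) \<in> ordLess"
  shows "\<exists>T. T \<subseteq> H \<and> H \<subseteq> module_span R M T \<and> (card_of T, \<beta>) \<in> ordLess"
proof (cases "finite S")
  case True
  have "H \<subseteq> module_span R M S" using submoduleE(1)[OF H] S(2) by simp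
  then obtain T where T: "finite T" "T \<subseteq> H" "H \<subseteq> module_span R M T"
    using noetherian_submodule_finitely_generated[OF noeth True S(1) H] by blast
  have "(card_of T, \<beta>) \<in> ordLess"
    using T(1) \<beta>(1) by (intro Cfinite_ordLess_Cinfinite) (auto simp: cfinite_def card_of_Card_order)
  then show ?thesis using T by blast
next
  case False
  have "\<exists>T. finite T \<and> T \<subseteq> H \<and> H \<inter> module_span R M F \<subseteq> module_span R M T" if F: "F \<in> Fpow S" for F
  proof -
    have Fc: "F \<subseteq> carrier M" "finite F" using F S(1) by (auto simp: Fpow_def)
    have U: "submodule (module_span R M F) R M" by (rule submodule_module_span[OF Fc(1)])
    show ?thesis
      using noetherian_submodule_finitely_generated[OF noeth Fc(2,1) submodule_Int[OF H U] Int_lower2]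
      by blast
  qed
  then have "\<forall>F\<in>Fpow S. \<exists>T. finite T \<and> T \<subseteq> H \<and> H \<inter> module_span R M F \<subseteq> module_span R M T"
    by (rule ballI)
  from bchoice[OF this] obtain t where
    "\<forall>F\<in>Fpow S. finite (t F) \<and> t F \<subseteq> H \<and> H \<inter> module_span R M F \<subseteq> module_span R M (t F)" ..
  then have t: "finite (t F)" "t F \<subseteq> H" "H \<inter> module_span R M F \<subseteq> module_span R M (t F)"
    if "F \<in> Fpow S" for F
    using that by simp_all
  let ?T = "\<Union>F\<in>Fpow S. t F"
  have "(card_of ?T, card_of S) \<in> ordLeq"
  proof (rule card_of_UNION_ordLeq_infinite[OF False])
    show "(card_of (Fpow S), card_of S) \<in> ordLeq"
      by (rule ordIso_imp_ordLeq[OF card_of_Fpow_infinite[OF False]])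
    show "\<forall>F\<in>Fpow S. (card_of (t F), card_of S) \<in> ordLeq"
      using t(1) False by (simp add: ordLeq3_finite_infinite)
  qed
  then have "(card_of ?T, \<beta>) \<in> ordLess" using \<beta>(2) by (rule ordLeq_ordLess_trans)
  moreover have "H \<subseteq> module_span R M ?T"
  proof
    fix z assume z: "z \<in> H"
    then have "z \<in> module_span R M S" using submoduleE(1)[OF H] S(2) by blast
    then obtain F where F: "F \<in> Fpow S" "z \<in> module_span R M F"
      unfolding Fpow_def using module_span_finite_support[of z R M S] by blast
    then have "z \<in> module_span R M (t F)" using t(3)[OF F(1)] z by blast
    then show "z \<in> module_span R M ?T" by (rule module_span_mono) (use F in blast)
  qed
  moreover have "?T \<subseteq> H" using t(2) by (rule UN_least)
  ultimately show ?thesis by blast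
qed

end

section \<open>Modules with few generators\<close>

lemma modules_gen_lessI:
  assumes "module R M" "S \<subseteq> carrier M" "carrier M \<subseteq> module_span R M S" "(card_of S, \<beta>) \<in> ordLess"
  shows "M \<in> modules_gen_less R \<beta>"
  using assms module.module_span_carrier[OF assms(1,2)]
  unfolding modules_gen_less_def by (auto simp: module_generates_iff_span[OF assms(1)])

lemma modules_gen_lessE:
  assumes "M \<in> modules_gen_less R \<beta>"
  obtains S where "module R M" "S \<subseteq> carrier M" "module_span R M S = carrier M"
    "(card_of S, \<beta>) \<in> ordLess"
  using assms unfolding modules_gen_less_def by (auto simp: module_generates_iff_span)

lemma modules_gen_less_quotient:
  assumes M: "M \<in> modules_gen_less R \<beta>" and Q: "module R Q"
    and q: "q \<in> module_hom R M Q" "q ` carrier M = carrier Q"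
  shows "Q \<in> modules_gen_less R \<beta>"
proof -
  obtain S where S: "module R M" "S \<subseteq> carrier M" "module_span R M S = carrier M"
    "(card_of S, \<beta>) \<in> ordLess" using M by (rule modules_gen_lessE)
  show ?thesis
  proof (rule modules_gen_lessI[OF Q])
    show "q ` S \<subseteq> carrier Q" using S(2) q(2) by blast
    show "carrier Q \<subseteq> module_span R Q (q ` S)"
      using module_hom_span[OF S(1) Q q(1) S(2)] S(3) q(2) by simp
    show "(card_of (q ` S), \<beta>) \<in> ordLess"
      by (rule ordLeq_ordLess_trans[OF card_of_image S(4)])
  qed
qed

text \<open>
  The submodule \<open>i ` carrier K\<close> has few generators; as \<open>i\<close> is injective, their preimages generate \<open>K\<close>.
\<close>

lemma modules_gen_less_sub:
  assumes noeth: "noetherian_ring R" and \<beta>: "Cinfinite \<beta>"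
    and M: "M \<in> modules_gen_less R \<beta>" and K: "module R K"
    and i: "i \<in> module_hom R K M" "inj_on i (carrier K)"
  shows "K \<in> modules_gen_less R \<beta>"
proof -
  obtain S where S: "module R M" "S \<subseteq> carrier M" "module_span R M S = carrier M"
    "(card_of S, \<beta>) \<in> ordLess" using M by (rule modules_gen_lessE)
  interpret M: module R M by fact
  obtain T where T: "T \<subseteq> i ` carrier K" "i ` carrier K \<subseteq> module_span R M T"
    "(card_of T, \<beta>) \<in> ordLess"
    using M.noetherian_submodule_generators[OF noeth S(2,3) submodule_image[OF K S(1) i(1)] \<beta> S(4)]
    by blast
  let ?T = "inv_into (carrier K) i ` T"
  have Tc: "?T \<subseteq> carrier K" using T(1) by (auto intro: inv_into_into)
  have iT: "i ` ?T = T" using T(1) by (rule image_inv_into_cancel[OF refl])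
  show ?thesis
  proof (rule modules_gen_lessI[OF K Tc])
    show "(card_of ?T, \<beta>) \<in> ordLess"
      by (rule ordLeq_ordLess_trans[OF card_of_image T(3)])
    have "i ` carrier K \<subseteq> i ` module_span R K ?T"
      using module_hom_span[OF K S(1) i(1) Tc] T(2) iT by simp
    then show "carrier K \<subseteq> module_span R K ?T"
      using inj_on_image_mem_iff[OF i(2) _ module.module_span_carrier[OF K Tc]] by blast
  qed
qed

text \<open>
  Images of generators of \<open>K\<close> together with lifts of generators of \<open>Q\<close> generate \<open>E\<close>; they are fewer
  than \<open>\<beta>\<close> as \<open>\<beta>\<close> is infinite.
\<close>

lemma modules_gen_less_extension:
  assumes \<beta>: "Cinfinite \<beta>" and K: "K \<in> modules_gen_less R \<beta>" and Q: "Q \<in> modules_gen_less R \<beta>"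
    and ex: "short_exact R K E Q i q"
  shows "E \<in> modules_gen_less R \<beta>"
proof -
  obtain S where S: "module R K" "S \<subseteq> carrier K" "module_span R K S = carrier K"
    "(card_of S, \<beta>) \<in> ordLess" using K by (rule modules_gen_lessE)
  obtain T where T: "module R Q" "T \<subseteq> carrier Q" "module_span R Q T = carrier Q"
    "(card_of T, \<beta>) \<in> ordLess" using Q by (rule modules_gen_lessE)
  have E: "module R E" and i: "i \<in> module_hom R K E" and q: "q \<in> module_hom R E Q"
    and iK: "i ` carrier K = a_kernel E Q q" and qE: "q ` carrier E = carrier Q"
    using ex by (auto simp: short_exact_def)
  interpret E: module R E by fact
  interpret Q: module R Q by (rule T(1))
  let ?T = "inv_into (carrier E) q ` T"
  have "T \<subseteq> q ` carrier E" using T(2) qE by simp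
  then have Tc: "?T \<subseteq> carrier E" by (auto intro: inv_into_into)
  have qT: "q ` ?T = T" using qE T(2) by (rule image_inv_into_cancel)
  let ?S = "i ` S \<union> ?T"
  have Sc: "?S \<subseteq> carrier E" using S(2) module_hom_closed[OF i] Tc by blast
  show ?thesis
  proof (rule modules_gen_lessI[OF E Sc])
    show "(card_of ?S, \<beta>) \<in> ordLess"
      by (intro Un_Cinfinite_bound_strict[OF _ _ \<beta>] ordLeq_ordLess_trans[OF card_of_image] S(4) T(4))
    show "carrier E \<subseteq> module_span R E ?S"
    proof
      fix e assume e: "e \<in> carrier E"
      then have "q e \<in> q ` module_span R E ?T"
        using module_hom_span[OF E T(1) q Tc] T(3) qT qE by auto
      then obtain e' where e': "e' \<in> module_span R E ?T" "q e = q e'" by blast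
      have e'c: "e' \<in> carrier E" using e'(1) E.module_span_carrier[OF Tc] by blast
      have "q (e \<oplus>\<^bsub>E\<^esub> \<ominus>\<^bsub>E\<^esub> e') = \<zero>\<^bsub>Q\<^esub>"
        using e e'c e'(2) module_hom_closed[OF q]
        by (simp add: module_hom_add[OF q] module_hom_neg[OF E T(1) q] Q.r_neg)
      then have "e \<oplus>\<^bsub>E\<^esub> \<ominus>\<^bsub>E\<^esub> e' \<in> i ` carrier K"
        using e e'c by (simp add: iK mem_a_kernel)
      also have "i ` carrier K = module_span R E (i ` S)"
        using module_hom_span[OF S(1) E i S(2)] S(3) by simp
      finally have "e \<oplus>\<^bsub>E\<^esub> \<ominus>\<^bsub>E\<^esub> e' \<in> module_span R E ?S" by (rule module_span_mono) blast
      moreover have "e' \<in> module_span R E ?S" using e'(1) by (rule module_span_mono) blast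
      ultimately have "(e \<oplus>\<^bsub>E\<^esub> \<ominus>\<^bsub>E\<^esub> e') \<oplus>\<^bsub>E\<^esub> e' \<in> module_span R E ?S"
        by (rule E.submoduleE(5)[OF E.submodule_module_span[OF Sc]])
      then show "e \<in> module_span R E ?S" using e e'c by (simp add: E.a_assoc E.l_neg)
    qed
  qed
qed

lemma modules_gen_less_nonempty:
  assumes R: "cring R" and \<beta>: "Cinfinite \<beta>"
  shows "(modules_gen_less R \<beta> :: ('r, 'v) module set) \<noteq> {}"
proof -
  define Z :: "('r, 'v) module" where "Z = \<lparr>carrier = {undefined}, monoid.mult = undefined,
    one = undefined, zero = undefined, add = \<lambda>_ _. undefined, smult = \<lambda>_ _. undefined\<rparr>"
  have "module R Z"
    by (rule moduleI[OF R abelian_groupI]) (simp_all add: Z_def)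
  moreover have "carrier Z \<subseteq> module_span R Z {}"
    using module_span.zero[of Z R "{}"] by (simp add: Z_def)
  moreover have "(card_of ({} :: 'v set), \<beta>) \<in> ordLess"
    by (rule Cfinite_ordLess_Cinfinite[OF _ \<beta>]) (simp add: cfinite_def card_of_Card_order)
  ultimately have "Z \<in> modules_gen_less R \<beta>" by (intro modules_gen_lessI) auto
  then show ?thesis by blast
qed

lemma weak_serre_modules_gen_less:
  assumes R: "cring R" and noeth: "noetherian_ring R" and \<beta>: "Cinfinite \<beta>"
  shows "weak_serre R (modules_gen_less R \<beta>)"
  unfolding weak_serre_def
proof (intro conjI ballI allI impI)
  show "modules_gen_less R \<beta> \<noteq> {}" by (rule modules_gen_less_nonempty[OF R \<beta>])
  show "module R M" if "M \<in> modules_gen_less R \<beta>" for M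
    using that by (simp add: modules_gen_less_def)
next
  fix M N assume M: "M \<in> modules_gen_less R \<beta>" and N: "module R N \<and> module_isomorphic R M N"
  then obtain f where "f \<in> module_hom R M N" "f ` carrier M = carrier N"
    by (auto simp: module_isomorphic_def bij_betw_def)
  then show "N \<in> modules_gen_less R \<beta>"
    using N by (intro modules_gen_less_quotient[OF M]) auto
next
  fix M N f K i assume M: "M \<in> modules_gen_less R \<beta>" and K: "is_module_kernel R M N f K i"
  show "K \<in> modules_gen_less R \<beta>"
    by (rule modules_gen_less_sub[OF noeth \<beta> M]) (use K in \<open>auto simp: is_module_kernel_def\<close>)
next
  fix M N f Q q assume N: "N \<in> modules_gen_less R \<beta>" and Q: "is_module_cokernel R M N f Q q"
  show "Q \<in> modules_gen_less R \<beta>"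
    by (rule modules_gen_less_quotient[OF N]) (use Q in \<open>auto simp: is_module_cokernel_def\<close>)
next
  fix K Q E i q assume "K \<in> modules_gen_less R \<beta>" "Q \<in> modules_gen_less R \<beta>" "short_exact R K E Q i q"
  then show "E \<in> modules_gen_less R \<beta>" by (rule modules_gen_less_extension[OF \<beta>])
qed

section \<open>Exact sequences in a triangulated category\<close>

lemma hom_group_simps [simp]:
  "carrier (hom_group D X Y) = arr D X Y"
  "zero (hom_group D X Y) = zer D X Y"
  "add (hom_group D X Y) = pls D"
  by (simp_all add: hom_group_def)

lemma isomorphic_sym: "isomorphic D X Y \<Longrightarrow> isomorphic D Y X"
  unfolding isomorphic_def is_iso_def by blast

context category
begin

lemma is_iso_ide: "X \<in> obj D \<Longrightarrow> is_iso D X X (ide D X)"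
  unfolding is_iso_def using ide_arr ide_left by blast

lemma isomorphic_refl: "X \<in> obj D \<Longrightarrow> isomorphic D X X"
  unfolding isomorphic_def using is_iso_ide by blast

end

context additive_category
begin

lemma zer_arr: "\<lbrakk>X \<in> obj D; Y \<in> obj D\<rbrakk> \<Longrightarrow> zer D X Y \<in> arr D X Y"
  using abelian_groupE(2)[OF hom_abelian_group, of X Y] by simp

lemma neg_arr:
  "\<lbrakk>X \<in> obj D; Y \<in> obj D; f \<in> arr D X Y\<rbrakk> \<Longrightarrow> \<ominus>\<^bsub>hom_group D X Y\<^esub> f \<in> arr D X Y"
  using abelian_group.a_inv_closed[OF hom_abelian_group, of X Y f] by simp

lemma neg_neg:
  "\<lbrakk>X \<in> obj D; Y \<in> obj D; f \<in> arr D X Y\<rbrakk>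
    \<Longrightarrow> \<ominus>\<^bsub>hom_group D X Y\<^esub> (\<ominus>\<^bsub>hom_group D X Y\<^esub> f) = f"
  using abelian_group.minus_minus[OF hom_abelian_group, of X Y f] by simp

text \<open>
  Composition on either side and the shift are additive maps between hom groups; their compatibility
  with zero arrows and negatives is derived once, for an arbitrary additive \<open>F\<close>.
\<close>

lemma additive_group_hom:
  assumes "X \<in> obj D" "Y \<in> obj D" "X' \<in> obj D" "Y' \<in> obj D"
    and "\<And>f. f \<in> arr D X Y \<Longrightarrow> F f \<in> arr D X' Y'"
    and "\<And>f g. \<lbrakk>f \<in> arr D X Y; g \<in> arr D X Y\<rbrakk> \<Longrightarrow> F (pls D f g) = pls D (F f) (F g)"
  shows "group_hom (add_monoid (hom_group D X Y)) (add_monoid (hom_group D X' Y')) F"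
proof -
  interpret G: abelian_group "hom_group D X Y" by (rule hom_abelian_group[OF assms(1,2)])
  interpret H: abelian_group "hom_group D X' Y'" by (rule hom_abelian_group[OF assms(3,4)])
  show ?thesis using assms(5,6) by unfold_locales (auto simp: hom_def)
qed

lemma additive_zero:
  assumes "X \<in> obj D" "Y \<in> obj D" "X' \<in> obj D" "Y' \<in> obj D"
    and "\<And>f. f \<in> arr D X Y \<Longrightarrow> F f \<in> arr D X' Y'"
    and "\<And>f g. \<lbrakk>f \<in> arr D X Y; g \<in> arr D X Y\<rbrakk> \<Longrightarrow> F (pls D f g) = pls D (F f) (F g)"
  shows "F (zer D X Y) = zer D X' Y'"
  using group_hom.hom_one[OF additive_group_hom[OF assms]] by simp

lemma additive_neg:
  assumes "X \<in> obj D" "Y \<in> obj D" "X' \<in> obj D" "Y' \<in> obj D"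
    and "\<And>f. f \<in> arr D X Y \<Longrightarrow> F f \<in> arr D X' Y'"
    and "\<And>f g. \<lbrakk>f \<in> arr D X Y; g \<in> arr D X Y\<rbrakk> \<Longrightarrow> F (pls D f g) = pls D (F f) (F g)"
    and "f \<in> arr D X Y"
  shows "F (\<ominus>\<^bsub>hom_group D X Y\<^esub> f) = \<ominus>\<^bsub>hom_group D X' Y'\<^esub> F f"
  using group_hom.hom_inv[OF additive_group_hom[OF assms(1-6)], of f] assms(7)
  by (simp add: a_inv_def)

lemma comp_zer_left:
  "\<lbrakk>X \<in> obj D; Y \<in> obj D; Z \<in> obj D; f \<in> arr D X Y\<rbrakk> \<Longrightarrow> zer D Y Z \<cdot> f = zer D X Z"
  by (rule additive_zero[where F = "\<lambda>g. g \<cdot> f"]) (auto intro: comp_arr comp_plus_left)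

lemma comp_zer_right:
  "\<lbrakk>X \<in> obj D; Y \<in> obj D; Z \<in> obj D; g \<in> arr D Y Z\<rbrakk> \<Longrightarrow> g \<cdot> zer D X Y = zer D X Z"
  by (rule additive_zero[where F = "\<lambda>f. g \<cdot> f"]) (auto intro: comp_arr comp_plus_right)

lemma comp_neg_left:
  "\<lbrakk>X \<in> obj D; Y \<in> obj D; Z \<in> obj D; f \<in> arr D X Y; g \<in> arr D Y Z\<rbrakk>
    \<Longrightarrow> (\<ominus>\<^bsub>hom_group D Y Z\<^esub> g) \<cdot> f = \<ominus>\<^bsub>hom_group D X Z\<^esub> (g \<cdot> f)"
  by (rule additive_neg[where F = "\<lambda>g. g \<cdot> f"]) (auto intro: comp_arr comp_plus_left)

lemma comp_neg_right:
  "\<lbrakk>X \<in> obj D; Y \<in> obj D; Z \<in> obj D; f \<in> arr D X Y; g \<in> arr D Y Z\<rbrakk>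
    \<Longrightarrow> g \<cdot> (\<ominus>\<^bsub>hom_group D X Y\<^esub> f) = \<ominus>\<^bsub>hom_group D X Z\<^esub> (g \<cdot> f)"
  by (rule additive_neg[where F = "\<lambda>f. g \<cdot> f"]) (auto intro: comp_arr comp_plus_right)

lemma arr_to_zero_obj:
  assumes "is_zero_obj D Z" "X \<in> obj D" "f \<in> arr D X Z"
  shows "f = zer D X Z"
  using assms ide_left comp_zer_left unfolding is_zero_obj_def by metis

lemma orth_iff:
  "\<lbrakk>X \<in> obj D; Y \<in> obj D\<rbrakk> \<Longrightarrow> orth D X Y \<longleftrightarrow> (\<forall>f\<in>arr D X Y. f = zer D X Y)"
  unfolding orth_def using zer_arr by blast

lemma orth_iso_left:
  assumes XY: "X \<in> obj D" "X' \<in> obj D" "Y \<in> obj D" and iso: "isomorphic D X X'" and o: "orth D X Y"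
  shows "orth D X' Y"
proof -
  obtain u v where uv: "u \<in> arr D X X'" "v \<in> arr D X' X" "u \<cdot> v = ide D X'"
    using iso by (auto simp: isomorphic_def is_iso_def)
  have "f = zer D X' Y" if f: "f \<in> arr D X' Y" for f
  proof -
    have "f \<cdot> u = zer D X Y" using o XY f uv comp_arr[of X X' Y u f] by (simp add: orth_def)
    have "f = (f \<cdot> u) \<cdot> v"
      using XY f uv by (simp add: comp_assoc[of X' X X' Y] ide_right)
    also have "\<dots> = zer D X' Y" using \<open>f \<cdot> u = _\<close> XY uv by (simp add: comp_zer_left)
    finally show ?thesis .
  qed
  then show ?thesis using XY by (simp add: orth_iff)
qed

lemma orth_iso_right:
  assumes XY: "X \<in> obj D" "Y \<in> obj D" "Y' \<in> obj D" and iso: "isomorphic D Y Y'" and o: "orth D X Y"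
  shows "orth D X Y'"
proof -
  obtain u v where uv: "u \<in> arr D Y Y'" "v \<in> arr D Y' Y" "u \<cdot> v = ide D Y'"
    using iso by (auto simp: isomorphic_def is_iso_def)
  have "f = zer D X Y'" if f: "f \<in> arr D X Y'" for f
  proof -
    have "v \<cdot> f = zer D X Y" using o XY f uv comp_arr[of X Y' Y f v] by (simp add: orth_def)
    have "f = u \<cdot> (v \<cdot> f)"
      using XY f uv by (simp add: comp_assoc[of X Y' Y Y', symmetric] ide_left)
    also have "\<dots> = zer D X Y'" using \<open>v \<cdot> f = _\<close> XY uv by (simp add: comp_zer_right)
    finally show ?thesis .
  qed
  then show ?thesis using XY by (simp add: orth_iff)
qed

end

context shift_category
begin

lemma shift_arr: "\<lbrakk>X \<in> obj D; Y \<in> obj D; f \<in> arr D X Y\<rbrakk> \<Longrightarrow> shiftA D f \<in> arr D (shift D X) (shift D Y)"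
  using shift_bij[of X Y] by (auto simp: bij_betw_def)

lemma shift_full:
  assumes "X \<in> obj D" "Y \<in> obj D" "g \<in> arr D (shift D X) (shift D Y)"
  obtains f where "f \<in> arr D X Y" "g = shiftA D f"
  using shift_bij[of X Y] assms by (auto simp: bij_betw_def)

lemma shift_faithful:
  "\<lbrakk>X \<in> obj D; Y \<in> obj D; f \<in> arr D X Y; g \<in> arr D X Y; shiftA D f = shiftA D g\<rbrakk> \<Longrightarrow> f = g"
  using shift_bij[of X Y] by (auto simp: bij_betw_def inj_on_def)

lemma shift_zer: "\<lbrakk>X \<in> obj D; Y \<in> obj D\<rbrakk> \<Longrightarrow> shiftA D (zer D X Y) = zer D (shift D X) (shift D Y)"
  by (rule additive_zero[where F = "shiftA D"]) (auto intro: shift_arr shift_plus shift_obj)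

lemma orth_shift_iff:
  assumes "X \<in> obj D" "Y \<in> obj D"
  shows "orth D (shift D X) (shift D Y) \<longleftrightarrow> orth D X Y"
  using assms shift_obj shift_zer shift_arr shift_full shift_faithful zer_arr
  by (smt (verit) orth_iff)

lemma zero_obj_shift: "is_zero_obj D Z \<Longrightarrow> is_zero_obj D (shift D Z)"
  unfolding is_zero_obj_def using shift_obj shift_ide shift_zer by metis

end

context triangulated_category
begin

lemma rotate:
  assumes "(X, Y, Z, f, g, h) \<in> tri D"
  shows "(Y, Z, shift D X, g, h, \<ominus>\<^bsub>hom_group D (shift D X) (shift D Y)\<^esub> shiftA D f) \<in> tri D"
  using TR2[of X Y Z f g h] dist_wf[OF assms] assms by blast

text \<open>
  Rotating a triangle backwards requires a desuspension of its third object. It exists up to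
  isomorphism only, and the sign that the rotation introduces is absorbed into the new arrow \<open>k\<close>.
\<close>

lemma rotate_back:
  assumes t: "(X, Y, Z, f, g, h) \<in> tri D" and W: "W \<in> obj D" "isomorphic D (shift D W) Z"
  obtains k g' where "(W, X, Y, k, f, g') \<in> tri D"
proof -
  have wf: "X \<in> obj D" "Y \<in> obj D" "Z \<in> obj D" "f \<in> arr D X Y" "g \<in> arr D Y Z" "h \<in> arr D Z (shift D X)"
    using dist_wf[OF t] by auto
  note ob = wf(1-3) W(1) shift_obj[OF wf(1)] shift_obj[OF W(1)]
  obtain c c' where c: "c \<in> arr D (shift D W) Z" "c' \<in> arr D Z (shift D W)"
    "c \<cdot> c' = ide D Z" "c' \<cdot> c = ide D (shift D W)"
    using W(2) by (auto simp: isomorphic_def is_iso_def)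
  have g': "c' \<cdot> g \<in> arr D Y (shift D W)" and h': "h \<cdot> c \<in> arr D (shift D W) (shift D X)"
    using comp_arr ob wf c by blast+
  have "(X, Y, shift D W, f, c' \<cdot> g, h \<cdot> c) \<in> tri D"
  proof (rule TR1_iso[OF t, where a = "ide D X" and b = "ide D Y" and c = c'])
    show "is_iso D Z (shift D W) c'" unfolding is_iso_def using c by blast
    show "shiftA D (ide D X) \<cdot> h = (h \<cdot> c) \<cdot> c'"
      using ob wf c by (simp add: shift_ide ide_left ide_right comp_assoc[of Z "shift D W" Z "shift D X"])
  qed (use ob wf g' h' in \<open>auto simp: is_iso_ide ide_left ide_right\<close>)
  moreover obtain k where k: "k \<in> arr D W X" "\<ominus>\<^bsub>hom_group D (shift D W) (shift D X)\<^esub> (h \<cdot> c) = shiftA D k"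
    using shift_full[OF W(1) wf(1) neg_arr[OF ob(6,5) h']] .
  then have "\<ominus>\<^bsub>hom_group D (shift D W) (shift D X)\<^esub> shiftA D k = h \<cdot> c"
    using neg_neg[OF ob(6,5) h'] by simp
  ultimately have "(W, X, Y, k, f, c' \<cdot> g) \<in> tri D"
    using TR2[of W X Y k f "c' \<cdot> g"] ob wf k g' by simp
  then show ?thesis by (rule that)
qed

text \<open>
  Comparing the triangle of the identity of \<open>X\<close> with the given one factors the composite through a zero
  object.
\<close>

lemma triangle_comp_zero:
  assumes t: "(X, Y, Z, f, g, h) \<in> tri D"
  shows "g \<cdot> f = zer D X Z"
proof -
  have wf: "X \<in> obj D" "Y \<in> obj D" "Z \<in> obj D" "f \<in> arr D X Y" "g \<in> arr D Y Z"
    using dist_wf[OF t] by auto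
  obtain E where E: "is_zero_obj D E" using zero_obj_exists by blast
  then have E0: "E \<in> obj D" by (simp add: is_zero_obj_def)
  obtain c where "c \<in> arr D E Z" "c \<cdot> zer D X E = g \<cdot> f"
    using TR3[OF TR1_ide[OF wf(1) E] t ide_arr[OF wf(1)] wf(4)] by blast
  then show ?thesis using comp_zer_right[OF wf(1) E0 wf(3)] by metis
qed

text \<open>
  An arrow \<open>\<phi>\<close> killed by \<open>g\<close> extends to a morphism from the rotated triangle
  \<open>M \<rightarrow> 0 \<rightarrow> M[1] \<rightarrow> M[1]\<close> to the rotated given one. Its third component is the shift of the required lift
  \<open>\<psi>\<close>; the two signs from the rotations cancel.
\<close>

lemma exact_hom_from:
  assumes t: "(X, Y, Z, f, g, h) \<in> tri D" and M: "M \<in> obj D"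
    and \<phi>: "\<phi> \<in> arr D M Y" "g \<cdot> \<phi> = zer D M Z"
  obtains \<psi> where "\<psi> \<in> arr D M X" "f \<cdot> \<psi> = \<phi>"
proof -
  have wf: "X \<in> obj D" "Y \<in> obj D" "Z \<in> obj D" "f \<in> arr D X Y" "g \<in> arr D Y Z"
    using dist_wf[OF t] by auto
  note ob = wf(1-3) M shift_obj[OF wf(1)] shift_obj[OF wf(2)] shift_obj[OF M]
  obtain E where E: "is_zero_obj D E" using zero_obj_exists by blast
  then have E0: "E \<in> obj D" by (simp add: is_zero_obj_def)
  have M1: "ide D (shift D M) \<in> arr D (shift D M) (shift D M)" by (rule ide_arr[OF ob(7)])
  have sq: "zer D E Z \<cdot> zer D M E = g \<cdot> \<phi>"
    using \<phi> comp_zer_left[OF M E0 wf(3) zer_arr[OF M E0]] by simp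
  obtain c where c: "c \<in> arr D (shift D M) (shift D X)"
    "shiftA D \<phi> \<cdot> (\<ominus>\<^bsub>hom_group D (shift D M) (shift D M)\<^esub> shiftA D (ide D M)) =
      (\<ominus>\<^bsub>hom_group D (shift D X) (shift D Y)\<^esub> shiftA D f) \<cdot> c"
    using TR3[OF rotate[OF TR1_ide[OF M E]] rotate[OF t] \<phi>(1) zer_arr[OF E0 wf(3)] sq] by blast
  obtain \<psi> where \<psi>: "\<psi> \<in> arr D M X" "c = shiftA D \<psi>" using shift_full[OF M wf(1) c(1)] .
  have f\<psi>: "f \<cdot> \<psi> \<in> arr D M Y" by (rule comp_arr[OF M wf(1,2) \<psi>(1) wf(4)])
  have s: "shiftA D \<phi> \<in> arr D (shift D M) (shift D Y)" "shiftA D f \<in> arr D (shift D X) (shift D Y)"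
    using shift_arr M wf \<phi>(1) by auto
  have "\<ominus>\<^bsub>hom_group D (shift D M) (shift D Y)\<^esub> shiftA D \<phi> =
      \<ominus>\<^bsub>hom_group D (shift D M) (shift D Y)\<^esub> (shiftA D (f \<cdot> \<psi>))"
    using c \<psi> s ob wf M1
    by (simp add: shift_ide comp_neg_right comp_neg_left ide_right shift_comp[of M X Y])
  then have "shiftA D \<phi> = shiftA D (f \<cdot> \<psi>)"
    using neg_neg[OF ob(7,6)] s(1) shift_arr[OF M wf(2) f\<psi>] by metis
  then have "f \<cdot> \<psi> = \<phi>" using shift_faithful[OF M wf(2) \<phi>(1) f\<psi>] by simp
  then show ?thesis using that \<psi>(1) by blast
qed

text \<open>
  An arrow \<open>\<phi>\<close> that kills \<open>f\<close> is the middle component of a morphism to the triangle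
  \<open>0 \<rightarrow> N \<rightarrow> N \<rightarrow> 0\<close>, which is obtained by rotating the triangle of the identity of \<open>N\<close> backwards.
\<close>

lemma exact_hom_to:
  assumes t: "(X, Y, Z, f, g, h) \<in> tri D" and N: "N \<in> obj D"
    and \<phi>: "\<phi> \<in> arr D Y N" "\<phi> \<cdot> f = zer D X N"
  obtains \<psi> where "\<psi> \<in> arr D Z N" "\<psi> \<cdot> g = \<phi>"
proof -
  have wf: "X \<in> obj D" "Y \<in> obj D" "Z \<in> obj D" "f \<in> arr D X Y" "g \<in> arr D Y Z"
    using dist_wf[OF t] by auto
  obtain E where E: "is_zero_obj D E" using zero_obj_exists by blast
  then have E0: "E \<in> obj D" by (simp add: is_zero_obj_def)
  obtain k g' where "(E, N, N, k, ide D N, g') \<in> tri D"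
    using rotate_back[OF TR1_ide[OF N zero_obj_shift[OF E]] E0 isomorphic_refl[OF shift_obj[OF E0]]] .
  moreover from this have k: "k \<in> arr D E N" using dist_wf by blast
  ultimately obtain c where "c \<in> arr D Z N" "c \<cdot> g = ide D N \<cdot> \<phi>"
    using TR3[OF t _ zer_arr[OF wf(1) E0] \<phi>(1)] \<phi>(2) comp_zer_right[OF wf(1) E0 N k] by metis
  then show ?thesis using that \<phi>(1) ide_left[OF wf(2) N] by metis
qed

end

section \<open>Hom modules\<close>

lemma hom_module_simps [simp]:
  "carrier (hom_module D sm M N) = arr D M N"
  "zero (hom_module D sm M N) = zer D M N"
  "add (hom_module D sm M N) = pls D"
  "smult (hom_module D sm M N) = (\<lambda>r f. f \<cdot>\<^bsub>D\<^esub> sm r (ide D M))"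
  by (simp_all add: hom_module_def hom_group_def ring.defs module.defs)

lemma triangulated_subcategoryD:
  assumes "triangulated_subcategory D S"
  shows "X \<in> S \<Longrightarrow> X \<in> obj D"
    and "S \<noteq> {}"
    and "\<lbrakk>X \<in> S; Y \<in> obj D; isomorphic D X Y\<rbrakk> \<Longrightarrow> Y \<in> S"
    and "X \<in> obj D \<Longrightarrow> shift D X \<in> S \<longleftrightarrow> X \<in> S"
    and "\<lbrakk>(X, Y, Z, f, g, h) \<in> tri D; X \<in> S; Y \<in> S\<rbrakk> \<Longrightarrow> Z \<in> S"
  using assms unfolding triangulated_subcategory_def iso_closed_def by blast+

context shift_category
begin

lemma triangulated_subcategory_desuspension:
  assumes S: "triangulated_subcategory D S" and X: "X \<in> S"
  obtains W where "W \<in> S" "isomorphic D (shift D W) X"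
proof -
  have X': "X \<in> obj D" by (rule triangulated_subcategoryD(1)[OF S X])
  obtain W where W: "W \<in> obj D" "isomorphic D (shift D W) X"
    using shift_ess_surj[OF X'] by blast
  have "shift D W \<in> S"
    by (rule triangulated_subcategoryD(3)[OF S X shift_obj[OF W(1)] isomorphic_sym[OF W(2)]])
  then have "W \<in> S" using triangulated_subcategoryD(4)[OF S W(1)] by blast
  then show ?thesis using W(2) by (rule that)
qed

end

context triangulated_category
begin

lemma inj_hom_to:
  assumes t: "(X, Y, Z, f, g, h) \<in> tri D" and N: "N \<in> obj D" "orth D Z N"
    and \<phi>: "\<phi> \<in> arr D Y N" "\<phi> \<cdot> f = zer D X N"
  shows "\<phi> = zer D Y N"
proof -
  obtain \<psi> where \<psi>: "\<psi> \<in> arr D Z N" "\<psi> \<cdot> g = \<phi>" using exact_hom_to[OF t N(1) \<phi>] .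
  then show ?thesis
    using N(2) dist_wf[OF t] comp_zer_left[of Y Z N g] N(1) by (simp add: orth_def)
qed

lemma surj_hom_to:
  assumes t: "(X, Y, Z, f, g, h) \<in> tri D" and N: "N \<in> obj D" "orth D X N"
  shows "(\<lambda>\<phi>. \<phi> \<cdot> g) ` arr D Z N = arr D Y N"
proof -
  have wf: "X \<in> obj D" "Y \<in> obj D" "Z \<in> obj D" "f \<in> arr D X Y" "g \<in> arr D Y Z"
    using dist_wf[OF t] by auto
  have "\<phi> \<in> (\<lambda>\<phi>. \<phi> \<cdot> g) ` arr D Z N" if \<phi>: "\<phi> \<in> arr D Y N" for \<phi>
  proof -
    have "\<phi> \<cdot> f = zer D X N" using comp_arr[OF wf(1,2) N(1) wf(4) \<phi>] N(2) by (simp add: orth_def)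
    then show ?thesis using exact_hom_to[OF t N(1) \<phi>] by blast
  qed
  then show ?thesis using comp_arr[OF wf(2,3) N(1) wf(5)] by blast
qed

lemma inj_hom_from:
  assumes t: "(X, Y, Z, f, g, h) \<in> tri D" and M: "M \<in> obj D" "orth D M X"
    and \<phi>: "\<phi> \<in> arr D M Y" "g \<cdot> \<phi> = zer D M Z"
  shows "\<phi> = zer D M Y"
proof -
  obtain \<psi> where \<psi>: "\<psi> \<in> arr D M X" "f \<cdot> \<psi> = \<phi>" using exact_hom_from[OF t M(1) \<phi>] .
  then show ?thesis
    using M(2) dist_wf[OF t] comp_zer_right[of M X Y f] M(1) by (simp add: orth_def)
qed

lemma surj_hom_from:
  assumes t: "(X, Y, Z, f, g, h) \<in> tri D" and M: "M \<in> obj D" "orth D M Z"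
  shows "(\<lambda>\<phi>. f \<cdot> \<phi>) ` arr D M X = arr D M Y"
proof -
  have wf: "X \<in> obj D" "Y \<in> obj D" "Z \<in> obj D" "f \<in> arr D X Y" "g \<in> arr D Y Z"
    using dist_wf[OF t] by auto
  have "\<phi> \<in> (\<lambda>\<phi>. f \<cdot> \<phi>) ` arr D M X" if \<phi>: "\<phi> \<in> arr D M Y" for \<phi>
  proof -
    have "g \<cdot> \<phi> = zer D M Z" using comp_arr[OF M(1) wf(2,3) \<phi> wf(5)] M(2) by (simp add: orth_def)
    then show ?thesis using exact_hom_from[OF t M(1) \<phi>] by blast
  qed
  then show ?thesis using comp_arr[OF M(1) wf(1,2) _ wf(4)] by blast
qed

end

text \<open>
  Fixing \<open>R\<close>, the linear subcategory \<open>C0\<close> and its scalar multiplication makes \<open>hom_module\<close> a functor of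
  two variables, contravariant on \<open>C0\<close> and covariant on the whole category.
\<close>

locale linear_triangulated_category = triangulated_category D + R: cring R
  for D :: "('o, 'u, 'z) tricat_scheme" (structure) and R :: "('r, 'm) ring_scheme" +
  fixes C0 :: "'o set" and sm :: "'r \<Rightarrow> 'u \<Rightarrow> 'u"
  assumes C0: "triangulated_subcategory D C0"
    and linear: "linear_subcategory R D C0 sm"
begin

abbreviation hom_mod :: "'o \<Rightarrow> 'o \<Rightarrow> ('r, 'u) module" where "hom_mod \<equiv> hom_module D sm"

lemmas C0_obj = triangulated_subcategoryD(1)[OF C0]

lemma C0_shift: "X \<in> C0 \<Longrightarrow> shift D X \<in> C0"
  using triangulated_subcategoryD(4)[OF C0] C0_obj by blast

lemma end_module:
  assumes "M \<in> C0"
  shows "module R (ring.extend (hom_group D M M) (module.fields sm))"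
  using linear assms unfolding linear_subcategory_def by blast

lemma sm_comp:
  assumes "r \<in> carrier R" "X \<in> C0" "Y \<in> C0" "Z \<in> C0" "f \<in> arr D X Y" "g \<in> arr D Y Z"
  shows "sm r g \<cdot> f = sm r (g \<cdot> f)" "g \<cdot> sm r f = sm r (g \<cdot> f)"
  using linear assms unfolding linear_subcategory_def by blast+

lemma sm_shift:
  assumes "r \<in> carrier R" "X \<in> C0" "Y \<in> C0" "f \<in> arr D X Y"
  shows "shiftA D (sm r f) = sm r (shiftA D f)"
  using linear assms unfolding linear_subcategory_def by blast

text \<open>
  The scalar \<open>r\<close> acts on arrows out of \<open>M\<close> through the endomorphism \<open>sm r (ide D M)\<close>. Precomposition
  gives a right action, so \<open>scalar_mult\<close> is stated with the factors reversed; this is legitimate as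
  \<open>R\<close> is commutative.
\<close>

lemma scalar:
  assumes "M \<in> C0"
  shows scalar_arr: "r \<in> carrier R \<Longrightarrow> sm r (ide D M) \<in> arr D M M"
    and scalar_add: "\<lbrakk>r \<in> carrier R; s \<in> carrier R\<rbrakk>
      \<Longrightarrow> sm (r \<oplus>\<^bsub>R\<^esub> s) (ide D M) = pls D (sm r (ide D M)) (sm s (ide D M))"
    and scalar_one: "sm \<one>\<^bsub>R\<^esub> (ide D M) = ide D M"
    and scalar_mult: "\<lbrakk>r \<in> carrier R; s \<in> carrier R\<rbrakk>
      \<Longrightarrow> sm (r \<otimes>\<^bsub>R\<^esub> s) (ide D M) = sm s (ide D M) \<cdot> sm r (ide D M)"
proof -
  interpret E: module R "ring.extend (hom_group D M M) (module.fields sm)"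
    by (rule end_module[OF assms])
  have E: "carrier (ring.extend (hom_group D M M) (module.fields sm)) = arr D M M"
    "add (ring.extend (hom_group D M M) (module.fields sm)) = pls D"
    "smult (ring.extend (hom_group D M M) (module.fields sm)) = sm"
    by (simp_all add: hom_group_def ring.defs module.defs)
  have M: "M \<in> obj D" "ide D M \<in> arr D M M" using C0_obj[OF assms] ide_arr by auto
  show cl: "sm r (ide D M) \<in> arr D M M" if "r \<in> carrier R" for r
    using E.smult_closed[OF that, of "ide D M"] M by (simp add: E)
  show "sm (r \<oplus>\<^bsub>R\<^esub> s) (ide D M) = pls D (sm r (ide D M)) (sm s (ide D M))"
    if "r \<in> carrier R" "s \<in> carrier R"
    using E.smult_l_distr[OF that, of "ide D M"] M by (simp add: E)
  show "sm \<one>\<^bsub>R\<^esub> (ide D M) = ide D M"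
    using E.smult_one[of "ide D M"] M by (simp add: E)
  show "sm (r \<otimes>\<^bsub>R\<^esub> s) (ide D M) = sm s (ide D M) \<cdot> sm r (ide D M)"
    if rs: "r \<in> carrier R" "s \<in> carrier R"
  proof -
    have "sm (s \<otimes>\<^bsub>R\<^esub> r) (ide D M) = sm s (sm r (ide D M))"
      using E.smult_assoc1[OF rs(2,1), of "ide D M"] M by (simp add: E)
    also have "\<dots> = sm s (ide D M) \<cdot> sm r (ide D M)"
      using sm_comp(1)[OF rs(2) assms assms assms cl[OF rs(1)] M(2)] ide_left[OF M(1,1) cl[OF rs(1)]]
      by simp
    finally show ?thesis using rs by (simp add: R.m_comm)
  qed
qed

lemma hom_mod_module:
  assumes M: "M \<in> C0" and N: "N \<in> obj D"
  shows "module R (hom_mod M N)"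
proof (rule moduleI)
  have M': "M \<in> obj D" by (rule C0_obj[OF M])
  show "cring R" by (rule R.cring_axioms)
  interpret G: abelian_group "hom_group D M N" by (rule hom_abelian_group[OF M' N])
  show "abelian_group (hom_mod M N)"
    using abelian_groupE[OF hom_abelian_group[OF M' N]] by (intro abelian_groupI) simp_all
  note c = scalar_arr[OF M]
  show "r \<odot>\<^bsub>hom_mod M N\<^esub> f \<in> carrier (hom_mod M N)"
    if "r \<in> carrier R" "f \<in> carrier (hom_mod M N)" for r f
    using that comp_arr[OF M' M' N c[OF that(1)]] by simp
  show "(r \<oplus>\<^bsub>R\<^esub> s) \<odot>\<^bsub>hom_mod M N\<^esub> f = (r \<odot>\<^bsub>hom_mod M N\<^esub> f) \<oplus>\<^bsub>hom_mod M N\<^esub> (s \<odot>\<^bsub>hom_mod M N\<^esub> f)"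
    if "r \<in> carrier R" "s \<in> carrier R" "f \<in> carrier (hom_mod M N)" for r s f
    using that c by (simp add: scalar_add[OF M] comp_plus_right[OF M' M' N])
  show "r \<odot>\<^bsub>hom_mod M N\<^esub> (f \<oplus>\<^bsub>hom_mod M N\<^esub> g) = (r \<odot>\<^bsub>hom_mod M N\<^esub> f) \<oplus>\<^bsub>hom_mod M N\<^esub> (r \<odot>\<^bsub>hom_mod M N\<^esub> g)"
    if "r \<in> carrier R" "f \<in> carrier (hom_mod M N)" "g \<in> carrier (hom_mod M N)" for r f g
    using that c by (simp add: comp_plus_left[OF M' M' N])
  show "(r \<otimes>\<^bsub>R\<^esub> s) \<odot>\<^bsub>hom_mod M N\<^esub> f = r \<odot>\<^bsub>hom_mod M N\<^esub> (s \<odot>\<^bsub>hom_mod M N\<^esub> f)"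
    if "r \<in> carrier R" "s \<in> carrier R" "f \<in> carrier (hom_mod M N)" for r s f
    using that c by (simp add: scalar_mult[OF M] comp_assoc[OF M' M' M' N])
  show "\<one>\<^bsub>R\<^esub> \<odot>\<^bsub>hom_mod M N\<^esub> f = f" if "f \<in> carrier (hom_mod M N)" for f
    using that by (simp add: scalar_one[OF M] ide_right[OF M' N])
qed

lemma post_module_hom:
  assumes M: "M \<in> C0" and N: "N \<in> obj D" "N' \<in> obj D" and g: "g \<in> arr D N N'"
  shows "(\<lambda>\<phi>. g \<cdot> \<phi>) \<in> module_hom R (hom_mod M N) (hom_mod M N')"
proof (rule module_homI)
  note M' = C0_obj[OF M]
  show "g \<cdot> f \<in> carrier (hom_mod M N')" if "f \<in> carrier (hom_mod M N)" for f
    using that comp_arr[OF M' N _ g] by simp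
  show "g \<cdot> (f \<oplus>\<^bsub>hom_mod M N\<^esub> f') = (g \<cdot> f) \<oplus>\<^bsub>hom_mod M N'\<^esub> (g \<cdot> f')"
    if "f \<in> carrier (hom_mod M N)" "f' \<in> carrier (hom_mod M N)" for f f'
    using that comp_plus_right[OF M' N _ _ g] by simp
  show "g \<cdot> (r \<odot>\<^bsub>hom_mod M N\<^esub> f) = r \<odot>\<^bsub>hom_mod M N'\<^esub> (g \<cdot> f)"
    if "r \<in> carrier R" "f \<in> carrier (hom_mod M N)" for r f
    using that comp_assoc[OF M' M' N scalar_arr[OF M that(1)] _ g] by simp
qed

text \<open>
  Precomposition with \<open>f\<close> is linear since scalar endomorphisms are central: both
  \<open>sm r (ide D M') \<cdot> f\<close> and \<open>f \<cdot> sm r (ide D M)\<close> equal \<open>sm r f\<close>.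
\<close>

lemma pre_module_hom:
  assumes M: "M \<in> C0" "M' \<in> C0" and N: "N \<in> obj D" and f: "f \<in> arr D M M'"
  shows "(\<lambda>\<phi>. \<phi> \<cdot> f) \<in> module_hom R (hom_mod M' N) (hom_mod M N)"
proof (rule module_homI)
  note M1 = C0_obj[OF M(1)] and M2 = C0_obj[OF M(2)]
  show "\<phi> \<cdot> f \<in> carrier (hom_mod M N)" if "\<phi> \<in> carrier (hom_mod M' N)" for \<phi>
    using that comp_arr[OF M1 M2 N f] by simp
  show "(\<phi> \<oplus>\<^bsub>hom_mod M' N\<^esub> \<psi>) \<cdot> f = (\<phi> \<cdot> f) \<oplus>\<^bsub>hom_mod M N\<^esub> (\<psi> \<cdot> f)"
    if "\<phi> \<in> carrier (hom_mod M' N)" "\<psi> \<in> carrier (hom_mod M' N)" for \<phi> \<psi>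
    using that comp_plus_left[OF M1 M2 N f] by simp
  show "(r \<odot>\<^bsub>hom_mod M' N\<^esub> \<phi>) \<cdot> f = r \<odot>\<^bsub>hom_mod M N\<^esub> (\<phi> \<cdot> f)"
    if r: "r \<in> carrier R" and \<phi>: "\<phi> \<in> carrier (hom_mod M' N)" for r \<phi>
  proof -
    have \<phi>': "\<phi> \<in> arr D M' N" using \<phi> by simp
    have "sm r (ide D M') \<cdot> f = f \<cdot> sm r (ide D M)"
      using sm_comp(1)[OF r M(1,2,2) f ide_arr[OF M2]] sm_comp(2)[OF r M(1,1,2) ide_arr[OF M1] f]
      by (simp add: ide_left[OF M1 M2 f] ide_right[OF M1 M2 f])
    then show ?thesis
      using comp_assoc[OF M1 M2 M2 N f scalar_arr[OF M(2) r] \<phi>']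
        comp_assoc[OF M1 M1 M2 N scalar_arr[OF M(1) r] f \<phi>'] by simp
  qed
qed

lemma shift_module_hom:
  assumes M: "M \<in> C0" and N: "N \<in> obj D"
  shows "shiftA D \<in> module_hom R (hom_mod M N) (hom_mod (shift D M) (shift D N))"
proof (rule module_homI)
  note M' = C0_obj[OF M]
  show "shiftA D f \<in> carrier (hom_mod (shift D M) (shift D N))" if "f \<in> carrier (hom_mod M N)" for f
    using that shift_arr[OF M' N] by simp
  show "shiftA D (f \<oplus>\<^bsub>hom_mod M N\<^esub> g) = shiftA D f \<oplus>\<^bsub>hom_mod (shift D M) (shift D N)\<^esub> shiftA D g"
    if "f \<in> carrier (hom_mod M N)" "g \<in> carrier (hom_mod M N)" for f g
    using that shift_plus[OF M' N] by simp
  show "shiftA D (r \<odot>\<^bsub>hom_mod M N\<^esub> f) = r \<odot>\<^bsub>hom_mod (shift D M) (shift D N)\<^esub> shiftA D f"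
    if r: "r \<in> carrier R" and f: "f \<in> carrier (hom_mod M N)" for r f
    using f shift_comp[OF M' M' N scalar_arr[OF M r]] sm_shift[OF r M M ide_arr[OF M']]
    by (simp add: shift_ide[OF M'])
qed

lemma a_kernel_post:
  assumes t: "(X, Y, Z, f, g, h) \<in> tri D" and M: "M \<in> C0"
  shows "a_kernel (hom_mod M Y) (hom_mod M Z) (\<lambda>\<phi>. g \<cdot> \<phi>) = (\<lambda>\<phi>. f \<cdot> \<phi>) ` carrier (hom_mod M X)"
proof -
  have wf: "X \<in> obj D" "Y \<in> obj D" "Z \<in> obj D" "f \<in> arr D X Y" "g \<in> arr D Y Z"
    using dist_wf[OF t] by auto
  note M' = C0_obj[OF M]
  have "f \<cdot> \<psi> \<in> arr D M Y \<and> g \<cdot> (f \<cdot> \<psi>) = zer D M Z" if "\<psi> \<in> arr D M X" for \<psi>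
    using comp_arr[OF M' wf(1,2) that wf(4)] comp_assoc[OF M' wf(1-3) that wf(4,5)]
      triangle_comp_zero[OF t] comp_zer_left[OF M' wf(1,3) that] by simp
  then show ?thesis
    using exact_hom_from[OF t M'] by (auto simp: mem_a_kernel) blast
qed

lemma a_kernel_pre:
  assumes t: "(X, Y, Z, f, g, h) \<in> tri D" and N: "N \<in> obj D"
  shows "a_kernel (hom_mod Y N) (hom_mod X N) (\<lambda>\<phi>. \<phi> \<cdot> f) = (\<lambda>\<phi>. \<phi> \<cdot> g) ` carrier (hom_mod Z N)"
proof -
  have wf: "X \<in> obj D" "Y \<in> obj D" "Z \<in> obj D" "f \<in> arr D X Y" "g \<in> arr D Y Z"
    using dist_wf[OF t] by auto
  have "\<psi> \<cdot> g \<in> arr D Y N \<and> (\<psi> \<cdot> g) \<cdot> f = zer D X N" if "\<psi> \<in> arr D Z N" for \<psi>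
    using comp_arr[OF wf(2,3) N wf(5) that] comp_assoc[OF wf(1-3) N wf(4,5) that]
      triangle_comp_zero[OF t] comp_zer_right[OF wf(1,3) N that] by simp
  then show ?thesis
    using exact_hom_to[OF t N] by (auto simp: mem_a_kernel) blast
qed

lemma inj_pre:
  assumes t: "(X, Y, Z, f, g, h) \<in> tri D" and XY: "X \<in> C0" "Y \<in> C0"
    and N: "N \<in> obj D" "orth D Z N"
  shows "inj_on (\<lambda>\<phi>. \<phi> \<cdot> f) (carrier (hom_mod Y N))"
proof (rule module_hom_inj[OF hom_mod_module[OF XY(2) N(1)] hom_mod_module[OF XY(1) N(1)]])
  show "(\<lambda>\<phi>. \<phi> \<cdot> f) \<in> module_hom R (hom_mod Y N) (hom_mod X N)"
    using dist_wf[OF t] by (intro pre_module_hom XY N) auto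
qed (use inj_hom_to[OF t N] in simp)

lemma inj_post:
  assumes t: "(X, Y, Z, f, g, h) \<in> tri D" and M: "M \<in> C0" "orth D M X"
  shows "inj_on (\<lambda>\<phi>. g \<cdot> \<phi>) (carrier (hom_mod M Y))"
proof -
  have wf: "Y \<in> obj D" "Z \<in> obj D" "g \<in> arr D Y Z" using dist_wf[OF t] by auto
  show ?thesis
    by (rule module_hom_inj[OF hom_mod_module[OF M(1) wf(1)] hom_mod_module[OF M(1) wf(2)]
          post_module_hom[OF M(1) wf]])
      (use inj_hom_from[OF t C0_obj[OF M(1)] M(2)] in simp)
qed

text \<open>
  This is where the linearity of the shift enters: it makes the bijection on arrows an isomorphism of
  modules.
\<close>

lemma hom_mod_shift_iff:
  assumes A: "weak_serre R A" and M: "M \<in> C0" and N: "N \<in> obj D"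
  shows "hom_mod (shift D M) (shift D N) \<in> A \<longleftrightarrow> hom_mod M N \<in> A"
  using weak_serre_iso_iff[OF A hom_mod_module[OF M N] hom_mod_module[OF C0_shift[OF M] shift_obj[OF N]]
      shift_module_hom[OF M N]] shift_bij[OF C0_obj[OF M] N] by simp

lemma hom_mod_iso_right:
  assumes A: "weak_serre R A" and M: "M \<in> C0" and N: "N \<in> obj D" "N' \<in> obj D" "isomorphic D N N'"
    and h: "hom_mod M N \<in> A"
  shows "hom_mod M N' \<in> A"
proof -
  note M' = C0_obj[OF M]
  obtain u v where uv: "u \<in> arr D N N'" "v \<in> arr D N' N" "v \<cdot> u = ide D N" "u \<cdot> v = ide D N'"
    using N(3) by (auto simp: isomorphic_def is_iso_def)
  have "bij_betw (\<lambda>\<phi>. u \<cdot> \<phi>) (arr D M N) (arr D M N')"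
  proof (rule bij_betw_byWitness[where f' = "\<lambda>\<phi>. v \<cdot> \<phi>"])
    show "\<forall>\<phi>\<in>arr D M N. v \<cdot> (u \<cdot> \<phi>) = \<phi>"
      using comp_assoc[OF M' N(1,2,1) _ uv(1,2)] uv(3) ide_left[OF M' N(1)] by simp
    show "\<forall>\<phi>\<in>arr D M N'. u \<cdot> (v \<cdot> \<phi>) = \<phi>"
      using comp_assoc[OF M' N(2,1,2) _ uv(2,1)] uv(4) ide_left[OF M' N(2)] by simp
    show "(\<lambda>\<phi>. u \<cdot> \<phi>) ` arr D M N \<subseteq> arr D M N'" using comp_arr[OF M' N(1,2) _ uv(1)] by blast
    show "(\<lambda>\<phi>. v \<cdot> \<phi>) ` arr D M N' \<subseteq> arr D M N" using comp_arr[OF M' N(2,1) _ uv(2)] by blast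
  qed
  then show ?thesis
    using weak_serre_iso[OF A h hom_mod_module[OF M N(2)] post_module_hom[OF M N(1,2) uv(1)]] by simp
qed

lemma hom_mod_iso_left:
  assumes A: "weak_serre R A" and M: "M \<in> C0" "M' \<in> C0" "isomorphic D M M'" and N: "N \<in> obj D"
    and h: "hom_mod M N \<in> A"
  shows "hom_mod M' N \<in> A"
proof -
  note M1 = C0_obj[OF M(1)] and M2 = C0_obj[OF M(2)]
  obtain u v where uv: "u \<in> arr D M M'" "v \<in> arr D M' M" "v \<cdot> u = ide D M" "u \<cdot> v = ide D M'"
    using M(3) by (auto simp: isomorphic_def is_iso_def)
  have "bij_betw (\<lambda>\<phi>. \<phi> \<cdot> v) (arr D M N) (arr D M' N)"
  proof (rule bij_betw_byWitness[where f' = "\<lambda>\<phi>. \<phi> \<cdot> u"])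
    show "\<forall>\<phi>\<in>arr D M N. (\<phi> \<cdot> v) \<cdot> u = \<phi>"
      using comp_assoc[OF M1 M2 M1 N uv(1,2)] uv(3) ide_right[OF M1 N] by simp
    show "\<forall>\<phi>\<in>arr D M' N. (\<phi> \<cdot> u) \<cdot> v = \<phi>"
      using comp_assoc[OF M2 M1 M2 N uv(2,1)] uv(4) ide_right[OF M2 N] by simp
    show "(\<lambda>\<phi>. \<phi> \<cdot> v) ` arr D M N \<subseteq> arr D M' N" using comp_arr[OF M2 M1 N uv(2)] by blast
    show "(\<lambda>\<phi>. \<phi> \<cdot> u) ` arr D M' N \<subseteq> arr D M N" using comp_arr[OF M1 M2 N uv(1)] by blast
  qed
  then show ?thesis
    using weak_serre_iso[OF A h hom_mod_module[OF M(2) N] pre_module_hom[OF M(2,1) N uv(2)]] by simp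
qed

end

section \<open>The restricted t-structure\<close>

locale orthogonal_structures = linear_triangulated_category D R C0 sm
  for D :: "('o, 'u, 'z) tricat_scheme" (structure) and R :: "('r, 'm) ring_scheme"
    and C0 :: "'o set" and sm :: "'r \<Rightarrow> 'u \<Rightarrow> 'u" +
  fixes C wle wge tle tge :: "'o set" and A :: "('r, 'u) module set"
  assumes C: "triangulated_subcategory D C"
    and w: "weight_structure D C0 wle wge"
    and t: "t_structure D C tle tge"
    and orthogonal: "strictly_orthogonal D wle wge C tle tge"
    and A: "weak_serre R A"
begin

abbreviation CA :: "'o set" where "CA \<equiv> subcat_of_modules D sm C0 C A"

lemma CA_iff: "N \<in> CA \<longleftrightarrow> N \<in> C \<and> (\<forall>M\<in>C0. hom_mod M N \<in> A)"
  by (simp add: subcat_of_modules_def)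

lemmas C_obj = triangulated_subcategoryD(1)[OF C]

lemma CA_obj: "N \<in> CA \<Longrightarrow> N \<in> obj D"
  using C_obj by (simp add: CA_iff)

lemma CA_iso:
  assumes "N \<in> CA" "N' \<in> obj D" "isomorphic D N N'"
  shows "N' \<in> CA"
  using assms hom_mod_iso_right[OF A _ CA_obj[OF assms(1)] assms(2,3)]
    triangulated_subcategoryD(3)[OF C _ assms(2,3)] by (simp add: CA_iff)

lemma CA_shift_iff:
  assumes N: "N \<in> obj D"
  shows "shift D N \<in> CA \<longleftrightarrow> N \<in> CA"
proof
  assume "shift D N \<in> CA"
  then show "N \<in> CA"
    using triangulated_subcategoryD(4)[OF C N] hom_mod_shift_iff[OF A _ N] C0_shift
    by (simp add: CA_iff)
next
  assume "N \<in> CA"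
  then have NC: "shift D N \<in> C" and h: "hom_mod M N \<in> A" if "M \<in> C0" for M
    using triangulated_subcategoryD(4)[OF C N] that by (simp_all add: CA_iff)
  have "hom_mod M (shift D N) \<in> A" if M: "M \<in> C0" for M
  proof -
    \<comment> \<open>Arrows from \<open>M\<close> to \<open>N[1]\<close> are arrows from a desuspension of \<open>M\<close> to \<open>N\<close>.\<close>
    obtain W where W: "W \<in> C0" "isomorphic D (shift D W) M"
      using triangulated_subcategory_desuspension[OF C0 M] .
    show ?thesis
      by (rule hom_mod_iso_left[OF A C0_shift[OF W(1)] M W(2) shift_obj[OF N]])
        (simp add: hom_mod_shift_iff[OF A W(1) N] h[OF W(1)])
  qed
  moreover obtain M where "M \<in> C0" using triangulated_subcategoryD(2)[OF C0] by blast
  ultimately show "shift D N \<in> CA" using NC by (simp add: CA_iff)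
qed

lemma CA_cone:
  assumes tri: "(X, Y, Z, f, g, h) \<in> tri D" and XY: "X \<in> CA" "Y \<in> CA"
  shows "Z \<in> CA"
proof -
  have wf: "X \<in> obj D" "Y \<in> obj D" "Z \<in> obj D" "f \<in> arr D X Y" "g \<in> arr D Y Z"
    "h \<in> arr D Z (shift D X)"
    using dist_wf[OF tri] by auto
  note sh = shift_obj[OF wf(1)] shift_obj[OF wf(2)]
  let ?f1 = "\<ominus>\<^bsub>hom_group D (shift D X) (shift D Y)\<^esub> shiftA D f"
  have f1: "?f1 \<in> arr D (shift D X) (shift D Y)"
    by (rule neg_arr[OF sh shift_arr[OF wf(1,2,4)]])
  have S: "shift D X \<in> CA" "shift D Y \<in> CA" using XY CA_shift_iff wf(1,2) by auto
  have "hom_mod M Z \<in> A" if M: "M \<in> C0" for M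
  proof (rule weak_serre_five[OF A])
    show "hom_mod M X \<in> A" "hom_mod M Y \<in> A" "hom_mod M (shift D X) \<in> A" "hom_mod M (shift D Y) \<in> A"
      using XY S M by (simp_all add: CA_iff)
    show "module R (hom_mod M Z)" by (rule hom_mod_module[OF M wf(3)])
    show "(\<lambda>\<phi>. f \<cdot> \<phi>) \<in> module_hom R (hom_mod M X) (hom_mod M Y)"
      by (rule post_module_hom[OF M wf(1,2,4)])
    show "(\<lambda>\<phi>. g \<cdot> \<phi>) \<in> module_hom R (hom_mod M Y) (hom_mod M Z)"
      by (rule post_module_hom[OF M wf(2,3,5)])
    show "(\<lambda>\<phi>. h \<cdot> \<phi>) \<in> module_hom R (hom_mod M Z) (hom_mod M (shift D X))"
      by (rule post_module_hom[OF M wf(3) sh(1) wf(6)])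
    show "(\<lambda>\<phi>. ?f1 \<cdot> \<phi>) \<in> module_hom R (hom_mod M (shift D X)) (hom_mod M (shift D Y))"
      by (rule post_module_hom[OF M sh f1])
  qed (rule a_kernel_post[OF tri M] a_kernel_post[OF rotate[OF tri] M]
      a_kernel_post[OF rotate[OF rotate[OF tri]] M])+
  moreover have "Z \<in> C"
    using triangulated_subcategoryD(5)[OF C tri] XY by (simp add: CA_iff)
  ultimately show ?thesis by (simp add: CA_iff)
qed

lemma CA_nonempty: "CA \<noteq> {}"
proof -
  obtain X where X: "X \<in> C" using triangulated_subcategoryD(2)[OF C] by blast
  obtain Z where Z: "is_zero_obj D Z" using zero_obj_exists by blast
  then have Z': "Z \<in> obj D" by (simp add: is_zero_obj_def)
  have "Z \<in> C"
    using triangulated_subcategoryD(5)[OF C TR1_ide[OF C_obj[OF X] Z] X X] .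
  moreover have "hom_mod M Z \<in> A" if M: "M \<in> C0" for M
  proof (rule weak_serre_zero[OF A hom_mod_module[OF M Z']])
    have "arr D M Z = {zer D M Z}"
      using arr_to_zero_obj[OF Z C0_obj[OF M]] zer_arr[OF C0_obj[OF M] Z'] by blast
    then show "carrier (hom_mod M Z) = {\<zero>\<^bsub>hom_mod M Z\<^esub>}" by simp
  qed
  ultimately have "Z \<in> CA" by (simp add: CA_iff)
  then show ?thesis by blast
qed

lemma triangulated_CA: "triangulated_subcategory D CA"
  unfolding triangulated_subcategory_def iso_closed_def
proof (intro conjI ballI allI impI)
  show "CA \<subseteq> obj D" using CA_obj by blast
  show "CA \<noteq> {}" by (rule CA_nonempty)
next
  fix X Y assume "X \<in> CA" "Y \<in> obj D" "isomorphic D X Y"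
  then show "Y \<in> CA" by (rule CA_iso)
next
  fix X assume "X \<in> obj D"
  then show "X \<in> CA \<longleftrightarrow> shift D X \<in> CA" by (simp only: CA_shift_iff)
next
  fix X Y Z f g h assume "(X, Y, Z, f, g, h) \<in> tri D \<and> X \<in> CA \<and> Y \<in> CA"
  then show "Z \<in> CA" using CA_cone by blast
qed

lemma weight:
  shows wle_C0: "X \<in> wle \<Longrightarrow> X \<in> C0"
    and wge_C0: "X \<in> wge \<Longrightarrow> X \<in> C0"
    and wge_retract: "\<lbrakk>Y \<in> wge; X \<in> C0; i \<in> arr D X Y; p \<in> arr D Y X; p \<cdot> i = ide D X\<rbrakk> \<Longrightarrow> X \<in> wge"
    and shift_up_wge: "X \<in> shift_up D wge \<Longrightarrow> X \<in> wge"
    and w_orth: "\<lbrakk>X \<in> wle; Y \<in> shift_up D wge\<rbrakk> \<Longrightarrow> orth D X Y"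
  using w unfolding weight_structure_def retract_closed_in_def by blast+

lemma weight_decomposition:
  assumes "M \<in> C0"
  obtains L Q f g h where "L \<in> wle" "Q \<in> shift_up D wge" "(L, M, Q, f, g, h) \<in> tri D"
proof -
  have "\<forall>M\<in>C0. \<exists>L\<in>wle. \<exists>R'\<in>shift_up D wge. \<exists>f g h. (L, M, R', f, g, h) \<in> tri D"
    using w unfolding weight_structure_def by (elim conjE)
  then show ?thesis using assms that by blast
qed

lemma shift_upI: "\<lbrakk>X \<in> S; X \<in> obj D\<rbrakk> \<Longrightarrow> shift D X \<in> shift_up D S"
  unfolding shift_up_def using shift_obj isomorphic_refl by blast

lemma shift_up_wgeE:
  assumes "P \<in> shift_up D wge"
  obtains P0 where "P0 \<in> wge" "isomorphic D (shift D P0) P"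
  using assms unfolding shift_up_def by blast

lemma orth_shift_up:
  assumes o: "\<And>P. P \<in> wge \<Longrightarrow> orth D P N" and N: "N \<in> obj D" and P: "P \<in> shift_up D wge"
  shows "orth D P (shift D N)"
proof -
  obtain P0 where P0: "P0 \<in> wge" "isomorphic D (shift D P0) P" using shift_up_wgeE[OF P] .
  have P0': "P0 \<in> obj D" by (rule C0_obj[OF wge_C0[OF P0(1)]])
  have "orth D (shift D P0) (shift D N)" using orth_shift_iff[OF P0' N] o[OF P0(1)] by simp
  then show ?thesis
    using orth_iso_left[OF shift_obj[OF P0'] C0_obj[OF wge_C0[OF shift_up_wge[OF P]]]
        shift_obj[OF N] P0(2)] by blast
qed

lemma tge_shift:
  assumes N: "N \<in> tge"
  shows "shift D N \<in> C" "\<And>X. X \<in> wle \<Longrightarrow> orth D X (shift D N)"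
proof -
  have "N \<in> obj D" using t N C_obj unfolding t_structure_def by blast
  then have "shift D N \<in> right_orth D wle \<inter> C"
    using shift_upI[OF N] orthogonal by (simp add: strictly_orthogonal_def)
  then show "shift D N \<in> C" "\<And>X. X \<in> wle \<Longrightarrow> orth D X (shift D N)"
    by (auto simp: right_orth_def)
qed

lemma tle_desuspension:
  assumes "N \<in> shift_down D tle" "P \<in> wge"
  shows "orth D P N"
  using assms orthogonal unfolding strictly_orthogonal_def right_orth_def by blast

text \<open>
  Two weight decompositions present \<open>Hom(M, N)\<close> as the cokernel of an arrow between modules \<open>Hom(Q', N)\<close> and
  \<open>Hom(Q, N)\<close> with \<open>Q\<close> and \<open>Q'\<close> in \<open>wge[1]\<close>: as \<open>wle\<close> is orthogonal to \<open>N\<close>, restriction from \<open>Hom(Q, N)\<close> to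
  \<open>Hom(M, N)\<close> is surjective, its kernel is the image of \<open>Hom(L[1], N)\<close>, and the same surjectivity for
  \<open>L[1]\<close> in place of \<open>M\<close> covers that module by \<open>Hom(Q', N)\<close>.
\<close>

lemma CA_if_hom_wge:
  assumes N: "N \<in> C" "\<And>X. X \<in> wle \<Longrightarrow> orth D X N"
    and h: "\<And>P. P \<in> shift_up D wge \<Longrightarrow> hom_mod P N \<in> A"
  shows "N \<in> CA"
proof -
  note N' = C_obj[OF N(1)]
  have "hom_mod M N \<in> A" if M: "M \<in> C0" for M
  proof -
    obtain L Q f g k where L: "L \<in> wle" and Q: "Q \<in> shift_up D wge"
      and tri: "(L, M, Q, f, g, k) \<in> tri D"
      using weight_decomposition[OF M] .
    note L0 = C0_shift[OF wle_C0[OF L]] and Q0 = wge_C0[OF shift_up_wge[OF Q]]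
    obtain L' Q' f' g' k' where L': "L' \<in> wle" and Q': "Q' \<in> shift_up D wge"
      and tri': "(L', shift D L, Q', f', g', k') \<in> tri D"
      using weight_decomposition[OF L0] .
    note Q0' = wge_C0[OF shift_up_wge[OF Q']]
    have ar: "g \<in> arr D M Q" "k \<in> arr D Q (shift D L)" "g' \<in> arr D (shift D L) Q'"
      using dist_wf[OF tri] dist_wf[OF tri'] by auto
    show ?thesis
    proof (rule weak_serre_cokernel[OF A h[OF Q'] h[OF Q]])
      show "(\<lambda>\<phi>. \<phi> \<cdot> g') \<in> module_hom R (hom_mod Q' N) (hom_mod (shift D L) N)"
        by (rule pre_module_hom[OF L0 Q0' N' ar(3)])
      show "(\<lambda>\<phi>. \<phi> \<cdot> g') ` carrier (hom_mod Q' N) = carrier (hom_mod (shift D L) N)"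
        using surj_hom_to[OF tri' N' N(2)[OF L']] by simp
      show "(\<lambda>\<phi>. \<phi> \<cdot> k) \<in> module_hom R (hom_mod (shift D L) N) (hom_mod Q N)"
        by (rule pre_module_hom[OF Q0 L0 N' ar(2)])
      show "module R (hom_mod M N)" by (rule hom_mod_module[OF M N'])
      show "(\<lambda>\<phi>. \<phi> \<cdot> g) \<in> module_hom R (hom_mod Q N) (hom_mod M N)"
        by (rule pre_module_hom[OF M Q0 N' ar(1)])
      show "(\<lambda>\<phi>. \<phi> \<cdot> g) ` carrier (hom_mod Q N) = carrier (hom_mod M N)"
        using surj_hom_to[OF tri N' N(2)[OF L]] by simp
      show "a_kernel (hom_mod Q N) (hom_mod M N) (\<lambda>\<phi>. \<phi> \<cdot> g) =
          (\<lambda>\<phi>. \<phi> \<cdot> k) ` carrier (hom_mod (shift D L) N)"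
        by (rule a_kernel_pre[OF rotate[OF tri] N'])
    qed
  qed
  then show ?thesis using N(1) by (simp add: CA_iff)
qed

text \<open>
  On \<open>wge[1]\<close> the objects \<open>L[1]\<close> and \<open>N[1]\<close> cannot be told apart, because neither \<open>Q\<close> nor \<open>Q[1]\<close>
  receives a nonzero arrow from it. So the criterion \<open>CA_if_hom_wge\<close> applies to \<open>L[1]\<close>.
\<close>

lemma CA_truncation:
  assumes N: "N \<in> CA" and L: "L \<in> tge" and Q: "Q \<in> shift_down D tle"
    and tri: "(L, N, Q, f, g, h) \<in> tri D"
  shows "L \<in> CA"
proof -
  have wf: "L \<in> obj D" "N \<in> obj D" "Q \<in> obj D" "f \<in> arr D L N" using dist_wf[OF tri] by auto
  note sh = shift_obj[OF wf(1)] shift_obj[OF wf(2)]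
  let ?f1 = "\<ominus>\<^bsub>hom_group D (shift D L) (shift D N)\<^esub> shiftA D f"
  have f1: "?f1 \<in> arr D (shift D L) (shift D N)"
    by (rule neg_arr[OF sh shift_arr[OF wf(1,2,4)]])
  have oQ: "orth D P Q" if "P \<in> wge" for P by (rule tle_desuspension[OF Q that])
  note tri2 = rotate[OF rotate[OF tri]]
  note tri3 = rotate[OF tri2]
  have "hom_mod P (shift D L) \<in> A" if P: "P \<in> shift_up D wge" for P
  proof -
    note Pw = shift_up_wge[OF P]
    note P0 = wge_C0[OF Pw]
    have "inj_on (\<lambda>\<phi>. ?f1 \<cdot> \<phi>) (arr D P (shift D L))"
      using inj_post[OF tri2 P0 oQ[OF Pw]] by simp
    moreover have "(\<lambda>\<phi>. ?f1 \<cdot> \<phi>) ` arr D P (shift D L) = arr D P (shift D N)"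
      by (rule surj_hom_from[OF tri3 C0_obj[OF P0] orth_shift_up[OF oQ wf(3) P]])
    ultimately have "hom_mod P (shift D L) \<in> A \<longleftrightarrow> hom_mod P (shift D N) \<in> A"
      by (intro weak_serre_iso_iff[OF A hom_mod_module[OF P0 sh(1)] hom_mod_module[OF P0 sh(2)]
            post_module_hom[OF P0 sh f1]]) (simp add: bij_betw_def)
    then show ?thesis using N CA_shift_iff[OF wf(2)] P0 by (simp add: CA_iff)
  qed
  then have "shift D L \<in> CA" by (intro CA_if_hom_wge tge_shift[OF L])
  then show ?thesis using CA_shift_iff[OF wf(1)] by simp
qed

lemma t_restricts_CA: "t_restricts D CA tle tge"
proof -
  have t': "tle \<subseteq> C" "tge \<subseteq> C" "iso_closed D tle" "iso_closed D tge"
    "tle \<subseteq> shift_up D tle" "shift_up D tge \<subseteq> tge" "\<forall>X\<in>shift_up D tge. \<forall>Y\<in>tle. orth D X Y"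
    "\<forall>M\<in>C. \<exists>L\<in>tge. \<exists>R'\<in>shift_down D tle. \<exists>f g h. (L, M, R', f, g, h) \<in> tri D"
    using t unfolding t_structure_def by simp_all
  have CA_unshift: "X \<in> CA" if "X \<in> obj D" "isomorphic D (shift D X) Y" "Y \<in> CA" for X Y
    using CA_iso[OF that(3) shift_obj[OF that(1)] isomorphic_sym[OF that(2)]] CA_shift_iff[OF that(1)]
    by simp
  show ?thesis
    unfolding t_restricts_def t_structure_def
  proof (intro conjI ballI)
    show "tle \<inter> CA \<subseteq> CA" "tge \<inter> CA \<subseteq> CA" by auto
    show "iso_closed D (tle \<inter> CA)" "iso_closed D (tge \<inter> CA)"
      using t'(3,4) CA_iso unfolding iso_closed_def by blast+
    show "tle \<inter> CA \<subseteq> shift_up D (tle \<inter> CA)"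
    proof
      fix Y assume Y: "Y \<in> tle \<inter> CA"
      then obtain X where X: "X \<in> tle" "isomorphic D (shift D X) Y" "Y \<in> obj D"
        using t'(5) unfolding shift_up_def by blast
      then have "X \<in> CA" using CA_unshift[of X Y] C_obj t'(1) Y by blast
      then show "Y \<in> shift_up D (tle \<inter> CA)" using X unfolding shift_up_def by blast
    qed
    show "shift_up D (tge \<inter> CA) \<subseteq> tge \<inter> CA"
    proof
      fix Y assume "Y \<in> shift_up D (tge \<inter> CA)"
      then obtain X where X: "X \<in> tge" "X \<in> CA" "isomorphic D (shift D X) Y" "Y \<in> obj D"
        unfolding shift_up_def by blast
      then have "shift D X \<in> CA" using CA_shift_iff CA_obj by blast
      then have "Y \<in> CA" using CA_iso X by blast
      moreover have "Y \<in> tge" using t'(6) X unfolding shift_up_def by blast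
      ultimately show "Y \<in> tge \<inter> CA" by blast
    qed
    show "orth D X Y" if "X \<in> shift_up D (tge \<inter> CA)" "Y \<in> tle \<inter> CA" for X Y
      using that t'(7) unfolding shift_up_def by blast
    fix M assume M: "M \<in> CA"
    then have "M \<in> C" by (simp add: CA_iff)
    then obtain L Q f g h where tri: "L \<in> tge" "Q \<in> shift_down D tle" "(L, M, Q, f, g, h) \<in> tri D"
      using t'(8) by blast
    have L: "L \<in> CA" by (rule CA_truncation[OF M tri])
    have Q: "Q \<in> CA" by (rule CA_cone[OF tri(3) L M])
    obtain Y where Y: "Y \<in> tle" "isomorphic D (shift D Q) Y"
      using tri(2) unfolding shift_down_def by blast
    have "Y \<in> CA"
      using CA_iso[OF _ C_obj Y(2)] CA_shift_iff[OF CA_obj[OF Q]] Q Y(1) t'(1) by blast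
    then have "Q \<in> shift_down D (tle \<inter> CA)"
      using Y CA_obj[OF Q] unfolding shift_down_def by blast
    then show "\<exists>L\<in>tge \<inter> CA. \<exists>R'\<in>shift_down D (tle \<inter> CA). \<exists>f g h. (L, M, R', f, g, h) \<in> tri D"
      using L tri by blast
  qed
qed

text \<open>
  The class \<open>wge\<close> contains everything in \<open>C0\<close> that is right orthogonal to \<open>wle[-1]\<close>: the first arrow of a
  weight decomposition of \<open>X[1]\<close> vanishes, which makes \<open>X[1]\<close> a retract of an object of \<open>wge[1]\<close>.
\<close>

lemma wge_memI:
  assumes X: "X \<in> C0" and o: "\<And>W. W \<in> wle \<Longrightarrow> orth D W (shift D X)"
  shows "X \<in> wge"
proof -
  note X' = C0_obj[OF X]
  note sX = shift_obj[OF X']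
  obtain L Q f g h where L: "L \<in> wle" and Q: "Q \<in> shift_up D wge"
    and tri: "(L, shift D X, Q, f, g, h) \<in> tri D"
    using weight_decomposition[OF C0_shift[OF X]] .
  have wf: "L \<in> obj D" "Q \<in> obj D" "f \<in> arr D L (shift D X)" "g \<in> arr D (shift D X) Q"
    using dist_wf[OF tri] by auto
  have "f = zer D L (shift D X)" using o[OF L] wf(3) by (simp add: orth_def)
  then have "ide D (shift D X) \<cdot> f = zer D L (shift D X)"
    using comp_zer_right[OF wf(1) sX sX ide_arr[OF sX]] by simp
  \<comment> \<open>So \<open>X[1]\<close> is a retract of \<open>Q\<close>; the retraction is transported along \<open>Y[1] \<simeq> Q\<close> and desuspended.\<close>
  then obtain \<psi> where \<psi>: "\<psi> \<in> arr D Q (shift D X)" "\<psi> \<cdot> g = ide D (shift D X)"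
    using exact_hom_to[OF tri sX ide_arr[OF sX]] by blast
  obtain Y where Y: "Y \<in> wge" "isomorphic D (shift D Y) Q" using shift_up_wgeE[OF Q] .
  note Y' = C0_obj[OF wge_C0[OF Y(1)]]
  note sY = shift_obj[OF Y']
  obtain c c' where c: "c \<in> arr D (shift D Y) Q" "c' \<in> arr D Q (shift D Y)" "c \<cdot> c' = ide D Q"
    using Y(2) by (auto simp: isomorphic_def is_iso_def)
  obtain i where i: "i \<in> arr D X Y" "c' \<cdot> g = shiftA D i"
    using shift_full[OF X' Y' comp_arr[OF sX wf(2) sY wf(4) c(2)]] .
  obtain p where p: "p \<in> arr D Y X" "\<psi> \<cdot> c = shiftA D p"
    using shift_full[OF Y' X' comp_arr[OF sY wf(2) sX c(1) \<psi>(1)]] .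
  have "shiftA D (p \<cdot> i) = (\<psi> \<cdot> c) \<cdot> (c' \<cdot> g)"
    using shift_comp[OF X' Y' X' i(1) p(1)] i(2) p(2) by simp
  also have "\<dots> = \<psi> \<cdot> (c \<cdot> (c' \<cdot> g))"
    by (rule comp_assoc[OF sX sY wf(2) sX comp_arr[OF sX wf(2) sY wf(4) c(2)] c(1) \<psi>(1)])
  also have "c \<cdot> (c' \<cdot> g) = g"
    using comp_assoc[OF sX wf(2) sY wf(2) wf(4) c(2,1)] c(3) ide_left[OF sX wf(2,4)] by simp
  finally have "shiftA D (p \<cdot> i) = shiftA D (ide D X)" using \<psi>(2) shift_ide[OF X'] by simp
  then have "p \<cdot> i = ide D X"
    by (rule shift_faithful[OF X' X' comp_arr[OF X' Y' X' i(1) p(1)] ide_arr[OF X']])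
  then show ?thesis by (rule wge_retract[OF Y(1) X i(1) p(1)])
qed

text \<open>
  A weight decomposition \<open>H \<rightarrow> P \<rightarrow> Q\<close> of an object of \<open>wge\<close>, rotated backwards. The object \<open>H\<close> is an
  extension of \<open>P\<close> by the desuspension of \<open>Q\<close>; both lie in \<open>wge\<close>, hence so does \<open>H\<close> by the
  orthogonality criterion for \<open>wge\<close>.
\<close>

lemma heart_approximation:
  assumes P: "P \<in> wge"
  obtains P' H k f g where "P' \<in> wge" "H \<in> heart wle wge" "(P', H, P, k, f, g) \<in> tri D"
proof -
  note P0 = wge_C0[OF P]
  obtain H Q f g h where H: "H \<in> wle" and Q: "Q \<in> shift_up D wge" and tri: "(H, P, Q, f, g, h) \<in> tri D"
    using weight_decomposition[OF P0] .
  have wf: "H \<in> obj D" "P \<in> obj D" "Q \<in> obj D" "h \<in> arr D Q (shift D H)" using dist_wf[OF tri] by auto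
  note sh = shift_obj[OF wf(1)] shift_obj[OF wf(2)]
  have "H \<in> wge"
  proof (rule wge_memI[OF wle_C0[OF H]])
    fix W assume W: "W \<in> wle"
    note W' = C0_obj[OF wle_C0[OF W]]
    \<comment> \<open>\<open>H[1]\<close> sits between \<open>Q\<close> and \<open>P[1]\<close>, and \<open>W\<close> is orthogonal to both.\<close>
    have oP: "orth D W (shift D P)" by (rule w_orth[OF W shift_upI[OF P wf(2)]])
    have "(\<lambda>\<phi>. h \<cdot> \<phi>) ` arr D W Q = arr D W (shift D H)"
      by (rule surj_hom_from[OF rotate[OF rotate[OF tri]] W' oP])
    moreover have "arr D W Q = {zer D W Q}" using w_orth[OF W Q] by (simp add: orth_def)
    ultimately show "orth D W (shift D H)"
      using comp_zer_right[OF W' wf(3) sh(1) wf(4)] by (simp add: orth_def)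
  qed
  then have "H \<in> heart wle wge" using H by (simp add: heart_def)
  moreover obtain P' where P': "P' \<in> wge" "isomorphic D (shift D P') Q" using shift_up_wgeE[OF Q] .
  moreover obtain k g' where "(P', H, P, k, f, g') \<in> tri D"
    using rotate_back[OF tri C0_obj[OF wge_C0[OF P'(1)]] P'(2)] .
  ultimately show ?thesis using that by blast
qed

text \<open>
  Two approximations present \<open>Hom(P, N)\<close>, for \<open>P\<close> in \<open>wge\<close>, as the kernel of an arrow between modules
  \<open>Hom(H, N)\<close> and \<open>Hom(H', N)\<close> with \<open>H\<close> and \<open>H'\<close> in the heart of the weight structure; injectivity holds as
  there are no nonzero arrows from \<open>wge[1]\<close> to \<open>N\<close>. Then \<open>CA_if_hom_wge\<close> applies to \<open>N[1]\<close>.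
\<close>

lemma CA_if_hom_heart:
  assumes N: "N \<in> heart tle tge" and h: "\<And>M. M \<in> heart wle wge \<Longrightarrow> hom_mod M N \<in> A"
  shows "N \<in> CA"
proof -
  have Nt: "N \<in> tle" "N \<in> tge" using N by (auto simp: heart_def)
  have N': "N \<in> obj D" using t Nt C_obj unfolding t_structure_def by blast
  have heart_C0: "M \<in> C0" if "M \<in> heart wle wge" for M
    using that wle_C0 by (simp add: heart_def)
  have o: "orth D P N" if P: "P \<in> shift_up D wge" for P
  proof -
    \<comment> \<open>Strict orthogonality concerns \<open>tle[-1]\<close>, hence the desuspension \<open>N1\<close> of \<open>N\<close>.\<close>
    obtain N1 where N1: "N1 \<in> obj D" "isomorphic D (shift D N1) N" using shift_ess_surj[OF N'] by blast
    then have "N1 \<in> shift_down D tle" using Nt(1) unfolding shift_down_def by blast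
    then have "orth D P (shift D N1)" by (intro orth_shift_up[OF tle_desuspension N1(1) P])
    then show ?thesis
      using orth_iso_right[OF C0_obj[OF wge_C0[OF shift_up_wge[OF P]]] shift_obj[OF N1(1)] N' N1(2)]
      by blast
  qed
  have hP: "hom_mod P N \<in> A" if P: "P \<in> wge" for P
  proof -
    obtain P1 H k f g where P1: "P1 \<in> wge" and H: "H \<in> heart wle wge" and tri: "(P1, H, P, k, f, g) \<in> tri D"
      using heart_approximation[OF P] .
    obtain P2 H' k' f' g' where P2: "P2 \<in> wge" and H': "H' \<in> heart wle wge"
      and tri': "(P2, H', P1, k', f', g') \<in> tri D"
      using heart_approximation[OF P1] .
    note c = wge_C0[OF P] wge_C0[OF P1] heart_C0[OF H] heart_C0[OF H']
    have ar: "k \<in> arr D P1 H" "f \<in> arr D H P" "f' \<in> arr D H' P1"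
      using dist_wf[OF tri] dist_wf[OF tri'] by auto
    have o1: "orth D (shift D P1) N" "orth D (shift D P2) N"
      using o shift_upI P1 P2 C0_obj wge_C0 by blast+
    show ?thesis
    proof (rule weak_serre_kernel[OF A h[OF H] h[OF H'] hom_mod_module[OF c(2) N']])
      show "(\<lambda>\<phi>. \<phi> \<cdot> k) \<in> module_hom R (hom_mod H N) (hom_mod P1 N)"
        by (rule pre_module_hom[OF c(2,3) N' ar(1)])
      show "(\<lambda>\<phi>. \<phi> \<cdot> f') \<in> module_hom R (hom_mod P1 N) (hom_mod H' N)"
        by (rule pre_module_hom[OF c(4,2) N' ar(3)])
      show "inj_on (\<lambda>\<phi>. \<phi> \<cdot> f') (carrier (hom_mod P1 N))"
        by (rule inj_pre[OF rotate[OF tri'] c(4,2) N' o1(2)])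
      show "module R (hom_mod P N)" by (rule hom_mod_module[OF c(1) N'])
      show "(\<lambda>\<phi>. \<phi> \<cdot> f) \<in> module_hom R (hom_mod P N) (hom_mod H N)"
        by (rule pre_module_hom[OF c(3,1) N' ar(2)])
      show "inj_on (\<lambda>\<phi>. \<phi> \<cdot> f) (carrier (hom_mod P N))"
        by (rule inj_pre[OF rotate[OF tri] c(3,1) N' o1(1)])
      show "(\<lambda>\<phi>. \<phi> \<cdot> f) ` carrier (hom_mod P N) =
          a_kernel (hom_mod H N) (hom_mod P1 N) (\<lambda>\<phi>. \<phi> \<cdot> k)"
        by (rule a_kernel_pre[OF tri N', symmetric])
    qed
  qed
  have "hom_mod P (shift D N) \<in> A" if P: "P \<in> shift_up D wge" for P
  proof -
    obtain P0 where P0: "P0 \<in> wge" "isomorphic D (shift D P0) P" using shift_up_wgeE[OF P] .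
    note c = wge_C0[OF P0(1)]
    show ?thesis
      by (rule hom_mod_iso_left[OF A C0_shift[OF c] wge_C0[OF shift_up_wge[OF P]] P0(2) shift_obj[OF N']])
        (simp add: hom_mod_shift_iff[OF A c N'] hP[OF P0(1)])
  qed
  then have "shift D N \<in> CA" by (intro CA_if_hom_wge tge_shift[OF Nt(2)])
  then show ?thesis using CA_shift_iff[OF N'] by simp
qed

lemma heart_CA:
  "heart (tle \<inter> CA) (tge \<inter> CA) = {N \<in> heart tle tge. \<forall>M\<in>heart wle wge. hom_mod M N \<in> A}"
proof
  show "heart (tle \<inter> CA) (tge \<inter> CA) \<subseteq> {N \<in> heart tle tge. \<forall>M\<in>heart wle wge. hom_mod M N \<in> A}"
    using wle_C0 by (auto simp: heart_def CA_iff)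
  show "{N \<in> heart tle tge. \<forall>M\<in>heart wle wge. hom_mod M N \<in> A} \<subseteq> heart (tle \<inter> CA) (tge \<inter> CA)"
  proof
    fix N assume N: "N \<in> {N \<in> heart tle tge. \<forall>M\<in>heart wle wge. hom_mod M N \<in> A}"
    then have "N \<in> CA" by (intro CA_if_hom_heart) auto
    then show "N \<in> heart (tle \<inter> CA) (tge \<inter> CA)" using N by (simp add: heart_def)
  qed
qed

end

theorem proposition2p4p5:
  fixes R :: "('r, 'm) ring_scheme"
    and D :: "('o, 'u, 'z) tricat_scheme"
    and sm :: "'r \<Rightarrow> 'u \<Rightarrow> 'u"
    and C0 C wle wge tle tge :: "'o set"
    and A A' :: "('r, 'u) module set"
  assumes "cring R"
    and "triangulated_category D"
    and "triangulated_subcategory D C0"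
    and "triangulated_subcategory D C"
    and "linear_subcategory R D C0 sm"
    and "weight_structure D C0 wle wge"
    and "t_structure D C tle tge"
    and "strictly_orthogonal D wle wge C tle tge"
    and "weak_serre R A"
    and "weak_serre R A'"
  shows "(triangulated_subcategory D (subcat_of_modules D sm C0 C A) \<and>
      t_restricts D (subcat_of_modules D sm C0 C A) tle tge \<and>
      heart (tle \<inter> subcat_of_modules D sm C0 C A) (tge \<inter> subcat_of_modules D sm C0 C A) =
        {N \<in> heart tle tge. \<forall>M\<in>heart wle wge. hom_module D sm M N \<in> A}) \<and>
    subcat_of_modules D sm C0 C (A \<inter> A') =
      subcat_of_modules D sm C0 C A \<inter> subcat_of_modules D sm C0 C A' \<and>
    (noetherian_ring R \<longrightarrow>
      (\<forall>\<beta> :: 'b rel. Cinfinite \<beta> \<longrightarrow>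
        weak_serre R (modules_gen_less R \<beta> :: ('r, 'v) module set)))"
proof -
  interpret orthogonal_structures D R C0 sm C wle wge tle tge A
    by (intro orthogonal_structures.intro linear_triangulated_category.intro
        linear_triangulated_category_axioms.intro orthogonal_structures_axioms.intro assms)
  show ?thesis
  proof (intro conjI impI allI)
    show "subcat_of_modules D sm C0 C (A \<inter> A') = CA \<inter> subcat_of_modules D sm C0 C A'"
      by (auto simp: subcat_of_modules_def)
    show "weak_serre R (modules_gen_less R \<beta> :: ('r, 'v) module set)"
      if "noetherian_ring R" "Cinfinite \<beta>" for \<beta> :: "'b rel"
      by (rule weak_serre_modules_gen_less[OF assms(1) that])
  qed (rule triangulated_CA t_restricts_CA heart_CA)+
qed

end
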